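(* Let $\mathcal S$ be an S-quad graph with associated graphs $\mathcal G$ and $\mathcal G^*$. Pairs of regular, dual spacelike two-sphere Koebe nets (with underlying graphs $\mathcal G,\mathcal G^*$) touching the upper parts of the spacelike spheres $S^2_+$ and $S^2_-$, with radii of absolute values $|r_+|$ and $|r_-|$, are in one-to-one correspondence with hyperbolic orthogonal ring patterns in the hyperbolic plane (with underlying S-quad graph $\mathcal S$) with global parameter $q=\frac{|r_-|}{|r_+|}$. Vertices of the Koebe nets correspond to centers of hyperbolic rings, and points of tangency of the Koebe nets correspond to touching points of the rings (in both cases by radial projection to the unit hyperboloid).
   Context: S-quad graph: a quad graph $\mathcal S$ with interior vertices of even degree such that (i) its vertices are properly bicolored black and white, $V=V_w\,\dot\cup\,V_b$; (ii) the white vertices are labeled s or c, $V_w=V_s\,\dot\cup\,V_c$, each quad having one white s- and one white c-vertex; (iii) interior black vertices and interior c-vertices have degree $4$. $\mathcal G$ is the quad graph with vertex set $V_s$, edges $\leftrightarrow V_b$, faces $\leftrightarrow V_c$; $\mathcal G^*$ is its dual graph with vertex set $V_c$. Edges of $\mathcal G$ are colored horizontal/vertical, alternating around each face; this extends to $\mathcal S$ (edge $(v,b)$ has the color of the $\mathcal G$-edge through $b$ if $v\in V_s$, the opposite color if $v\in V_c$), so that colors alternate around quads of $\mathcal S$. $\mathbb{R}^{2,1}$ carries $\langle x,y\rangle=x_1y_1+x_2y_2-x_3y_3$; $|x|:=|\sqrt{\langle x,x\rangle}|$. The upper part of a spacelike sphere centered at $0$ with squared radius $r_\pm^2<0$ is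 $S^2_\pm=\{x:\langle x,x\rangle=r_\pm^2,\ x_3>0\}$, $|r_\pm|=|\sqrt{r_\pm^2}|$. The hyperbolic plane is the hyperboloid $\{\langle x,x\rangle=-1,\ x_3>0\}$. Spacelike two-sphere Koebe net: a map $k$ from the vertices of $\mathcal G$ (or $\mathcal G^*$) to $\mathbb{R}^{2,1}$ with planar faces whose edges alternately touch $S_+^2$ and $S_-^2$, where $r_+^2r_-^2=1$, $|r_-|<|r_+|$; horizontal edges touch $S^2_-$, vertical edges touch $S^2_+$. Dual pair $(k^s,k^c)$ on $(\mathcal G,\mathcal G^* )$: (1) both touch the same $S^2_\pm$; (2) vertex vectors of one are normals (with respect to $\langle\cdot,\cdot\rangle$) of the corresponding faces of the other; (3) dual edges are orthogonal, their points of tangency lie on different spheres and project radially to the same point of the unit hyperboloid. Regular: at each vertex the adjacent points of tangency are cyclically ordered (clockwise or counterclockwise) according to the combinatorics. Projections: $p_v=k_v/|k_v|$ for vertices, $q_b=t_b^\pm/|r_\pm|$ for points of tangency. Hyperbolic ring: a triple $(p,r,R)$, $p$ a point of the hyperbolic plane, $R>0$ the outer and $r$ the signed inner hyperbolic radius ($r>0$ counterclockwise, $r<0$ clockwise orientation); it consists of the concentric circles about $p$ of radii $|r|$ and $R$. Hyperbolic orthogonal ring pattern on $\mathcal S$: rings $(p_v,r_v,R_v)$, $v\in V_w$, such that (1) for the two white vertices of each quad the larger circle of each ring intersects the smaller circle of the other orthogonally; (2) for each black vertex $b$ the inner circles of the rings at the white neighbors joined to $b$ by horizontal edges and the outer circles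 of the rings at the white neighbors joined to $b$ by vertical edges all pass through one point (touching point); (3) for each ring the touching points, in the cyclic order given by the combinatorics, are ordered counterclockwise if $r_v>0$, clockwise if $r_v<0$. For such a pattern there is a global constant $q<1$ (global parameter) with $q\cosh R_v=\cosh r_v$ for all $v$.
   Formalization: The Koebe nets are additionally required to have timelike vertex vectors, since spacelike or lightlike vertices have no radial projection to the unit hyperboloid and no ring corresponds to them; points of tangency and touching points are kept as part of the data. *)

theory Defs
  imports "HOL-Analysis.Analysis"
begin

section \<open>S-quad graphs\<close>

text \<open>
  An S-quad graph is given by its oriented quads. A quad \<open>(s, b, c, b')\<close> lists its vertices in
  counterclockwise order, starting at the white vertex labelled s; \<open>b\<close> and \<open>b'\<close> are black and
  \<open>c\<close> is the white vertex labelled c. Edges of the quad graph are determined by their endpoints.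
  The edges of the graph \<open>G\<close> (vertices \<open>Vs\<close>, faces \<open>Vc\<close>) and of its dual (vertices \<open>Vc\<close>,
  faces \<open>Vs\<close>) are both indexed by \<open>Vb\<close>; \<open>hor b\<close> says that the edge \<open>b\<close> of \<open>G\<close> is horizontal.
\<close>

record 'v squad =
  Vs :: "'v set"
  Vc :: "'v set"
  Vb :: "'v set"
  quads :: "('v \<times> 'v \<times> 'v \<times> 'v) set"
  hor :: "'v \<Rightarrow> bool"

text \<open>
  \<open>turn S v x y\<close>: some quad has a corner at \<open>v\<close>, and crossing this corner counterclockwise about
  \<open>v\<close> leads from the edge \<open>vx\<close> to the edge \<open>vy\<close>.
\<close>

definition turn :: "'v squad \<Rightarrow> 'v \<Rightarrow> 'v \<Rightarrow> 'v \<Rightarrow> bool" where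
  "turn S v x y \<longleftrightarrow> (\<exists>s b c b'. (s, b, c, b') \<in> quads S \<and>
     (v = s \<and> x = b \<and> y = b' \<or> v = b \<and> x = c \<and> y = s \<or>
      v = c \<and> x = b' \<and> y = b \<or> v = b' \<and> x = s \<and> y = c))"

definition adj :: "'v squad \<Rightarrow> 'v \<Rightarrow> 'v \<Rightarrow> bool" where
  "adj S v x \<longleftrightarrow> (\<exists>y. turn S v x y \<or> turn S v y x)"

definition opposite :: "'v squad \<Rightarrow> 'v \<Rightarrow> 'v \<Rightarrow> bool" where
  "opposite S v w \<longleftrightarrow> (\<exists>b b'. (v, b, w, b') \<in> quads S \<or> (w, b, v, b') \<in> quads S)"

text \<open>
  The neighbours of \<open>v\<close> in counterclockwise order: they are linked by the corners at \<open>v\<close> into one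
  path if \<open>v\<close> is a boundary vertex, and into one cycle if \<open>v\<close> is an interior vertex, whose degree
  is then \<open>length xs\<close>.
\<close>

definition boundary_star :: "'v squad \<Rightarrow> 'v \<Rightarrow> 'v list \<Rightarrow> bool" where
  "boundary_star S v xs \<longleftrightarrow> distinct xs \<and> 2 \<le> length xs \<and>
     (\<forall>x y. turn S v x y \<longleftrightarrow> (\<exists>i. Suc i < length xs \<and> x = xs ! i \<and> y = xs ! Suc i))"

definition interior_star :: "'v squad \<Rightarrow> 'v \<Rightarrow> 'v list \<Rightarrow> bool" where
  "interior_star S v xs \<longleftrightarrow> distinct xs \<and> xs \<noteq> [] \<and>
     (\<forall>x y. turn S v x y \<longleftrightarrow>
        (\<exists>i < length xs. x = xs ! i \<and> y = xs ! (Suc i mod length xs)))"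

definition s_quad_graph :: "'v squad \<Rightarrow> bool" where
  "s_quad_graph S \<longleftrightarrow>
     Vs S \<inter> Vc S = {} \<and> Vs S \<inter> Vb S = {} \<and> Vc S \<inter> Vb S = {} \<and>
     quads S \<subseteq> Vs S \<times> Vb S \<times> Vc S \<times> Vb S \<and>
     (\<forall>v \<in> Vs S \<union> Vc S \<union> Vb S. \<exists>xs. boundary_star S v xs \<or> interior_star S v xs) \<and>
     (\<forall>v \<in> Vs S \<union> Vc S \<union> Vb S. \<forall>xs. interior_star S v xs \<longrightarrow> even (length xs)) \<and>
     (\<forall>v \<in> Vb S \<union> Vc S. \<forall>xs. interior_star S v xs \<longrightarrow> length xs = 4) \<and>
     (\<forall>(s, b, c, b') \<in> quads S. hor S b \<noteq> hor S b')"

text \<open>The colour of the edge joining a white vertex \<open>v\<close> to a black vertex \<open>b\<close>.\<close>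

definition horizontal :: "'v squad \<Rightarrow> 'v \<Rightarrow> 'v \<Rightarrow> bool" where
  "horizontal S v b \<longleftrightarrow> (if v \<in> Vs S then hor S b else \<not> hor S b)"


section \<open>Lorentz space and the hyperbolic plane\<close>

definition lor :: "real ^ 3 \<Rightarrow> real ^ 3 \<Rightarrow> real" where
  "lor x y = x $ 1 * y $ 1 + x $ 2 * y $ 2 - x $ 3 * y $ 3"

text \<open>
  For timelike \<open>x\<close> the square root of \<open>lor x x\<close> is imaginary. The library's real square root is an
  odd function, so \<open>\<bar>sqrt a\<bar>\<close> is the modulus of the complex square roots of \<open>a\<close> also for \<open>a < 0\<close>.
\<close>

definition lnorm :: "real ^ 3 \<Rightarrow> real" where
  "lnorm x = \<bar>sqrt (lor x x)\<bar>"

definition proj :: "real ^ 3 \<Rightarrow> real ^ 3" where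
  "proj x = x /\<^sub>R lnorm x"

definition upper_sphere :: "real \<Rightarrow> (real ^ 3) set" where
  "upper_sphere rsq = {x. lor x x = rsq \<and> x $ 3 > 0}"

definition hyp :: "(real ^ 3) set" where
  "hyp = {x. lor x x = - 1 \<and> x $ 3 > 0}"

definition hdist :: "real ^ 3 \<Rightarrow> real ^ 3 \<Rightarrow> real" where
  "hdist x y = arcosh (- lor x y)"

definition hcircle :: "real ^ 3 \<Rightarrow> real \<Rightarrow> (real ^ 3) set" where
  "hcircle p \<rho> = {x \<in> hyp. hdist p x = \<rho>}"

text \<open>
  Tangent vectors at \<open>x\<close> of the circle through \<open>x\<close> about \<open>p\<close>: along the circle, \<open>lor x x\<close> and
  \<open>lor p x\<close> are constant.
\<close>

definition hcircle_tangent :: "real ^ 3 \<Rightarrow> real ^ 3 \<Rightarrow> real ^ 3 \<Rightarrow> bool" where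
  "hcircle_tangent p x u \<longleftrightarrow> lor u x = 0 \<and> lor u p = 0"

definition orthogonal_circles :: "real ^ 3 \<Rightarrow> real \<Rightarrow> real ^ 3 \<Rightarrow> real \<Rightarrow> bool" where
  "orthogonal_circles p \<rho> p' \<rho>' \<longleftrightarrow>
     hcircle p \<rho> \<inter> hcircle p' \<rho>' \<noteq> {} \<and>
     (\<forall>x \<in> hcircle p \<rho> \<inter> hcircle p' \<rho>'. \<forall>u u'.
        hcircle_tangent p x u \<longrightarrow> hcircle_tangent p' x u' \<longrightarrow> lor u u' = 0)"


section \<open>Cyclic order\<close>

text \<open>
  In what follows \<open>\<sigma>\<close> is \<open>1\<close> for counterclockwise and \<open>-1\<close> for clockwise. All notions are invariant
  under scaling vectors by positive factors, hence under radial projection.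

  \<open>rotates \<sigma> p x y\<close>: seen from \<open>p\<close>, the direction to \<open>x\<close> is turned into the direction to \<open>y\<close> by a
  rotation in the sense \<open>\<sigma>\<close> through an angle strictly between \<open>0\<close> and \<open>\<pi>\<close>.
\<close>

definition rotates :: "real \<Rightarrow> real ^ 3 \<Rightarrow> real ^ 3 \<Rightarrow> real ^ 3 \<Rightarrow> bool" where
  "rotates \<sigma> p x y \<longleftrightarrow> \<sigma> * det (vector [p, x, y] :: real ^ 3 ^ 3) > 0"

text \<open>
  Cyclic order of three directions about \<open>p\<close>: the three angles in the sense \<open>\<sigma>\<close> from \<open>x\<close> to \<open>y\<close>,
  from \<open>y\<close> to \<open>z\<close> and from \<open>z\<close> to \<open>x\<close> are positive with sum \<open>2\<pi>\<close>. Equivalently, at least two of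
  them are in \<open>(0, \<pi>)\<close>.
\<close>

definition cyclic3 :: "real \<Rightarrow> real ^ 3 \<Rightarrow> real ^ 3 \<Rightarrow> real ^ 3 \<Rightarrow> real ^ 3 \<Rightarrow> bool" where
  "cyclic3 \<sigma> p x y z \<longleftrightarrow>
     rotates \<sigma> p x y \<and> rotates \<sigma> p y z \<or>
     rotates \<sigma> p y z \<and> rotates \<sigma> p z x \<or>
     rotates \<sigma> p z x \<and> rotates \<sigma> p x y"

text \<open>
  The points \<open>f b\<close> at the neighbours \<open>b\<close> of \<open>v\<close>, taken in their combinatorial order, are cyclically
  ordered about \<open>p\<close> in the sense \<open>\<sigma>\<close>. A cyclic order of only two points carries no orientation; if
  \<open>v\<close> has just two neighbours (a boundary vertex in a single quad), the orientation is that of the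
  rotation by an angle less than \<open>\<pi>\<close> across the corner of the quad. The list \<open>xs\<close> exists for every
  vertex of an S-quad graph and is unique up to rotation, under which \<open>cyclic3\<close> is invariant.
\<close>

definition ordered_around ::
    "'v squad \<Rightarrow> real \<Rightarrow> real ^ 3 \<Rightarrow> ('v \<Rightarrow> real ^ 3) \<Rightarrow> 'v \<Rightarrow> bool" where
  "ordered_around S \<sigma> p f v \<longleftrightarrow> (\<forall>xs.
     boundary_star S v xs \<or> interior_star S v xs \<longrightarrow>
     (\<forall>i j k. i < j \<and> j < k \<and> k < length xs \<longrightarrow>
        cyclic3 \<sigma> p (f (xs ! i)) (f (xs ! j)) (f (xs ! k))) \<and>
     (length xs = 2 \<longrightarrow> (\<forall>b b'. turn S v b b' \<longrightarrow> rotates \<sigma> p (f b) (f b'))))"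


section \<open>Two-sphere Koebe nets\<close>

text \<open>
  A net consists of its vertices \<open>k\<close> and its points of tangency \<open>t\<close>. It is a net on \<open>G\<close> for
  \<open>W = Vs S\<close> and a net on the dual graph for \<open>W = Vc S\<close>. The points of tangency are
  recorded because at the boundary a black vertex \<open>b\<close> may have a single neighbour in \<open>W\<close>; its edge
  is then a half-edge, spanned by that neighbour and the point of tangency.
\<close>

type_synonym 'v net = "('v \<Rightarrow> real ^ 3) \<times> ('v \<Rightarrow> real ^ 3)"

definition edge_points :: "'v squad \<Rightarrow> 'v set \<Rightarrow> 'v net \<Rightarrow> 'v \<Rightarrow> (real ^ 3) set" where
  "edge_points S W N b = insert (snd N b) (fst N ` {v \<in> W. adj S v b})"

definition face_points :: "'v squad \<Rightarrow> 'v net \<Rightarrow> 'v \<Rightarrow> (real ^ 3) set" where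
  "face_points S N w = fst N ` {v. opposite S w v} \<union> snd N ` {b. adj S w b}"

text \<open>
  \<open>W\<close> is the set of vertices and \<open>W'\<close> the set of faces; \<open>hz\<close> is the set of horizontal edges, which
  touch the sphere with squared radius \<open>rm2\<close>, while the vertical ones touch that with \<open>rp2\<close>. An
  edge touches a sphere at \<open>t\<close> if its line passes through \<open>t\<close> and lies in the tangent plane at \<open>t\<close>.
\<close>

definition koebe_net ::
    "'v squad \<Rightarrow> 'v set \<Rightarrow> 'v set \<Rightarrow> 'v set \<Rightarrow> real \<Rightarrow> real \<Rightarrow> 'v net \<Rightarrow> bool" where
  "koebe_net S W W' hz rp2 rm2 N \<longleftrightarrow>
     fst N \<in> extensional W \<and> snd N \<in> extensional (Vb S) \<and>
     (\<forall>w \<in> W'. coplanar (face_points S N w)) \<and>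
     (\<forall>b \<in> Vb S.
        snd N b \<in> upper_sphere (if b \<in> hz then rm2 else rp2) \<and>
        collinear (edge_points S W N b) \<and>
        (\<forall>x \<in> edge_points S W N b. lor (x - snd N b) (snd N b) = 0))"

definition regular_net :: "'v squad \<Rightarrow> 'v set \<Rightarrow> 'v net \<Rightarrow> bool" where
  "regular_net S W N \<longleftrightarrow>
     (\<forall>v \<in> W. ordered_around S 1 (fst N v) (snd N) v \<or>
              ordered_around S (- 1) (fst N v) (snd N) v)"

text \<open>
  That dual edges touch different spheres is built into the colours: the edge \<open>b\<close> of the dual graph
  is horizontal iff the edge \<open>b\<close> of \<open>G\<close> is vertical.
\<close>

definition dual_nets :: "'v squad \<Rightarrow> real \<Rightarrow> real \<Rightarrow> 'v net \<Rightarrow> 'v net \<Rightarrow> bool" where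
  "dual_nets S rp2 rm2 Ns Nc \<longleftrightarrow>
     koebe_net S (Vs S) (Vc S) {b \<in> Vb S. hor S b} rp2 rm2 Ns \<and>
     koebe_net S (Vc S) (Vs S) {b \<in> Vb S. \<not> hor S b} rp2 rm2 Nc \<and>
     (\<forall>c \<in> Vc S. fst Nc c \<noteq> 0 \<and>
        (\<forall>x \<in> face_points S Ns c. \<forall>y \<in> face_points S Ns c. lor (fst Nc c) (x - y) = 0)) \<and>
     (\<forall>s \<in> Vs S. fst Ns s \<noteq> 0 \<and>
        (\<forall>x \<in> face_points S Nc s. \<forall>y \<in> face_points S Nc s. lor (fst Ns s) (x - y) = 0)) \<and>
     (\<forall>b \<in> Vb S.
        (\<forall>x \<in> edge_points S (Vs S) Ns b. \<forall>y \<in> edge_points S (Vs S) Ns b.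
         \<forall>x' \<in> edge_points S (Vc S) Nc b. \<forall>y' \<in> edge_points S (Vc S) Nc b.
           lor (x - y) (x' - y') = 0) \<and>
        proj (snd Ns b) = proj (snd Nc b))"

text \<open>
  The radial projection of a vertex to the unit hyperboloid exists only if the vertex is timelike;
  by tangency it then lies in the future cone.
\<close>

definition koebe_pairs :: "'v squad \<Rightarrow> real \<Rightarrow> real \<Rightarrow> ('v net \<times> 'v net) set" where
  "koebe_pairs S rp2 rm2 = {(Ns, Nc).
     dual_nets S rp2 rm2 Ns Nc \<and> regular_net S (Vs S) Ns \<and> regular_net S (Vc S) Nc \<and>
     (\<forall>s \<in> Vs S. lor (fst Ns s) (fst Ns s) < 0) \<and>
     (\<forall>c \<in> Vc S. lor (fst Nc c) (fst Nc c) < 0)}"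


section \<open>Hyperbolic orthogonal ring patterns\<close>

record hring =
  ctr :: "real ^ 3"
  inr :: real
  outr :: real

text \<open>The inner radius carries the orientation of the ring as its sign, so it is not zero.\<close>

definition is_hring :: "hring \<Rightarrow> bool" where
  "is_hring \<rho> \<longleftrightarrow> ctr \<rho> \<in> hyp \<and> inr \<rho> \<noteq> 0 \<and> \<bar>inr \<rho>\<bar> < outr \<rho>"

text \<open>A pattern consists of its rings \<open>\<rho>\<close> and its touching points \<open>q\<close>.\<close>

definition ring_pattern :: "'v squad \<Rightarrow> ('v \<Rightarrow> hring) \<Rightarrow> ('v \<Rightarrow> real ^ 3) \<Rightarrow> bool" where
  "ring_pattern S \<rho> q \<longleftrightarrow>
     \<rho> \<in> extensional (Vs S \<union> Vc S) \<and> q \<in> extensional (Vb S) \<and>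
     (\<forall>v \<in> Vs S \<union> Vc S. is_hring (\<rho> v)) \<and>
     (\<forall>(s, b, c, b') \<in> quads S.
        orthogonal_circles (ctr (\<rho> s)) (outr (\<rho> s)) (ctr (\<rho> c)) \<bar>inr (\<rho> c)\<bar> \<and>
        orthogonal_circles (ctr (\<rho> s)) \<bar>inr (\<rho> s)\<bar> (ctr (\<rho> c)) (outr (\<rho> c))) \<and>
     (\<forall>b \<in> Vb S. \<forall>v \<in> Vs S \<union> Vc S. adj S v b \<longrightarrow>
        q b \<in> hcircle (ctr (\<rho> v)) (if horizontal S v b then \<bar>inr (\<rho> v)\<bar> else outr (\<rho> v))) \<and>
     (\<forall>v \<in> Vs S \<union> Vc S.
        (inr (\<rho> v) > 0 \<longrightarrow> ordered_around S 1 (ctr (\<rho> v)) q v) \<and>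
        (inr (\<rho> v) < 0 \<longrightarrow> ordered_around S (- 1) (ctr (\<rho> v)) q v))"

definition global_parameter :: "'v squad \<Rightarrow> ('v \<Rightarrow> hring) \<Rightarrow> real \<Rightarrow> bool" where
  "global_parameter S \<rho> \<kappa> \<longleftrightarrow>
     (\<forall>v \<in> Vs S \<union> Vc S. \<kappa> * cosh (outr (\<rho> v)) = cosh (inr (\<rho> v)))"

definition ring_patterns :: "'v squad \<Rightarrow> real \<Rightarrow> (('v \<Rightarrow> hring) \<times> ('v \<Rightarrow> real ^ 3)) set" where
  "ring_patterns S \<kappa> = {(\<rho>, q). ring_pattern S \<rho> q \<and> global_parameter S \<rho> \<kappa>}"

end

theory Submission
  imports Defs
begin

text \<open>
  Write a dual pair as one map \<open>K\<close> on all white vertices, and let \<open>q\<close> be the common radial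
  projection of the points of tangency. Tangency says that \<open>lor (K v) (q b)\<close> is minus the radius
  of the sphere touched, and duality together with \<open>r\<^sub>+ r\<^sub>- = 1\<close> says that \<open>lor (K s) (K c) = - 1\<close>
  for the two white vertices of a quad. On the other side, circles about \<open>p\<close> and \<open>p'\<close> through a
  common point are orthogonal iff \<open>- lor p p'\<close> is the product of the hyperbolic cosines of their
  radii (the hyperbolic Pythagorean theorem). With \<open>p = K v / \<bar>K v\<bar>\<close>, \<open>cosh r = \<bar>r\<^sub>-\<bar> / \<bar>K v\<bar>\<close> and
  \<open>cosh R = \<bar>r\<^sub>+\<bar> / \<bar>K v\<bar>\<close> the two sets of equations coincide.
\<close>

section \<open>Linear algebra of the Lorentz form\<close>

text \<open>The Gram matrix of the form as a map. It turns \<open>lor\<close> into the Euclidean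
  inner product, so that library facts on cross products and hyperplanes apply.\<close>

definition lflip :: "real ^ 3 \<Rightarrow> real ^ 3" where
  "lflip x = vector [x $ 1, x $ 2, - x $ 3]"

lemma lor_lflip: "lor x y = lflip x \<bullet> y"
  by (simp add: lor_def lflip_def inner_vec_def sum_3)

lemma lflip_eq_0_iff [simp]: "lflip x = 0 \<longleftrightarrow> x = 0"
  by (auto simp: lflip_def vec_eq_iff forall_3)

lemma lor_commute: "lor x y = lor y x"
  by (simp add: lor_def mult.commute)

lemma lor_simps:
  "lor (x + y) z = lor x z + lor y z" "lor z (x + y) = lor z x + lor z y"
  "lor (x - y) z = lor x z - lor y z" "lor z (x - y) = lor z x - lor z y"
  "lor (c *\<^sub>R x) z = c * lor x z" "lor z (c *\<^sub>R x) = c * lor z x"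
  "lor 0 z = 0" "lor z 0 = 0"
  by (simp_all add: lor_def algebra_simps)

text \<open>A timelike \<open>x\<close> and a nonzero \<open>f\<close> orthogonal to it are
  independent, so their common orthogonal complement is a line; \<open>e\<close> spans it.\<close>

lemma parallel_if_lor_orthogonal:
  assumes x: "lor x x < 0" and f: "lor f x = 0" "f \<noteq> 0"
    and e: "lor e x = 0" "lor e f = 0" "e \<noteq> 0" and g: "lor g x = 0" "lor g f = 0"
  shows "\<exists>m. g = m *\<^sub>R e"
proof -
  have "cross3 e g = 0"
  proof (rule ccontr)
    assume n: "cross3 e g \<noteq> 0"
    \<comment> \<open>Expanding the triple product: a vector orthogonal to \<open>e\<close> and
      \<open>g\<close> becomes, after \<open>lflip\<close>, parallel to their cross product. Applied
      to \<open>x\<close> and \<open>f\<close>, this makes \<open>f\<close> a multiple of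
      \<open>x\<close>, hence zero.\<close>
    have "cross3 (lflip y) (cross3 e g) = 0" if "lor e y = 0" "lor g y = 0" for y
      using that by (simp add: Lagrange lor_lflip [symmetric] lor_commute)
    then have "collinear {0, cross3 e g, lflip x}" "collinear {0, cross3 e g, lflip f}"
      using e g by (simp_all add: cross_eq_0 [symmetric] cross_skew [of "cross3 e g"])
    moreover have "x \<noteq> 0" using x by (auto simp: lor_simps)
    ultimately obtain c d where cd: "lflip x = c *\<^sub>R cross3 e g" "lflip f = d *\<^sub>R cross3 e g"
      using n f by (auto simp: collinear_lemma)
    then have "c \<noteq> 0" using \<open>x \<noteq> 0\<close> by (metis lflip_eq_0_iff scale_zero_left)
    then have "lflip f = (d / c) *\<^sub>R lflip x" by (simp add: cd)
    then have "lor f x = (d / c) * lor x x" by (simp add: lor_lflip)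
    then have "d = 0" using x f \<open>c \<noteq> 0\<close> by simp
    then show False using cd f by (metis lflip_eq_0_iff scale_zero_left)
  qed
  then have "collinear {0, e, g}" by (simp add: cross_eq_0)
  then show ?thesis using e by (auto simp: collinear_lemma intro: exI [of _ 0])
qed

lemma hypD: assumes "x \<in> hyp" shows "lor x x = - 1" "x $ 3 > 0" "x \<noteq> 0"
  using assms by (auto simp: hyp_def)

text \<open>Reversed Cauchy-Schwarz in the future cone: the planar parts are shorter than the third
  coordinates, and Lagrange's identity bounds their product.\<close>

lemma lor_future_neg:
  assumes x: "lor x x < 0" "x $ 3 > 0" and y: "y \<in> hyp"
  shows "lor x y < 0"
proof -
  have xx: "(x$1)\<^sup>2 + (x$2)\<^sup>2 < (x$3)\<^sup>2" and yy: "(y$1)\<^sup>2 + (y$2)\<^sup>2 < (y$3)\<^sup>2"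
    using x hypD [OF y] by (auto simp: lor_def power2_eq_square)
  have "(x$1 * y$1 + x$2 * y$2)\<^sup>2 + (x$1 * y$2 - x$2 * y$1)\<^sup>2
      = ((x$1)\<^sup>2 + (x$2)\<^sup>2) * ((y$1)\<^sup>2 + (y$2)\<^sup>2)"
    by algebra
  also have "\<dots> < (x$3)\<^sup>2 * (y$3)\<^sup>2"
    using xx yy by (intro mult_strict_mono') auto
  finally have "(x$1 * y$1 + x$2 * y$2)\<^sup>2 < (x$3 * y$3)\<^sup>2"
    by (smt (verit) power_mult_distrib zero_le_power2)
  then have "x$1 * y$1 + x$2 * y$2 < x$3 * y$3"
    by (rule power_less_imp_less_base) (use x hypD [OF y] in simp)
  then show ?thesis by (simp add: lor_def)
qed

text \<open>Lagrange's identity for \<open>(1, x$1, x$2)\<close> and \<open>(1, y$1, y$2)\<close>: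
  the defect contains the squared planar distance, which is positive because a point of the
  hyperboloid is determined by its planar part.\<close>

lemma lor_hyp_less:
  assumes x: "x \<in> hyp" and y: "y \<in> hyp" and ne: "x \<noteq> y"
  shows "lor x y < - 1"
proof -
  have xx: "(x$3)\<^sup>2 = 1 + (x$1)\<^sup>2 + (x$2)\<^sup>2" and yy: "(y$3)\<^sup>2 = 1 + (y$1)\<^sup>2 + (y$2)\<^sup>2"
    using hypD [OF x] hypD [OF y] by (auto simp: lor_def power2_eq_square)
  have pos: "x$3 > 0" "y$3 > 0" using hypD [OF x] hypD [OF y] by auto
  have "x$1 \<noteq> y$1 \<or> x$2 \<noteq> y$2"
  proof (rule ccontr)
    assume *: "\<not> ?thesis"
    then have "(x$3)\<^sup>2 = (y$3)\<^sup>2" using xx yy by simp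
    then have "x$3 = y$3" using pos by (simp add: power2_eq_iff_nonneg)
    then show False using * ne by (auto simp: vec_eq_iff forall_3)
  qed
  then have "(x$1 - y$1)\<^sup>2 + (x$2 - y$2)\<^sup>2 > 0"
    by (simp add: sum_power2_gt_zero_iff)
  then have "(1 + x$1 * y$1 + x$2 * y$2)\<^sup>2
      < (1 + x$1 * y$1 + x$2 * y$2)\<^sup>2 + (x$1 * y$2 - x$2 * y$1)\<^sup>2 + ((x$1 - y$1)\<^sup>2 + (x$2 - y$2)\<^sup>2)"
    by (smt (verit) zero_le_power2)
  also have "\<dots> = (1 + (x$1)\<^sup>2 + (x$2)\<^sup>2) * (1 + (y$1)\<^sup>2 + (y$2)\<^sup>2)"
    by algebra
  also have "\<dots> = (x$3 * y$3)\<^sup>2" by (simp add: xx yy power_mult_distrib)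
  finally have "1 + x$1 * y$1 + x$2 * y$2 < x$3 * y$3"
    by (rule power_less_imp_less_base) (use pos in simp)
  then show ?thesis by (simp add: lor_def)
qed

text \<open>The set lies in a plane of affine dimension 2. Since \<open>coplanar\<close> asks for
  three points spanning a hull around the set, the argument passes to an affine basis of at most
  three points.\<close>

lemma coplanar_lor: assumes "n \<noteq> 0" "\<And>x. x \<in> X \<Longrightarrow> lor n x = c" shows "coplanar X"
proof -
  have sub: "X \<subseteq> {x. lflip n \<bullet> x = c}" using assms by (auto simp: lor_lflip)
  have "aff_dim X \<le> 2"
    using aff_dim_subset [OF sub] assms(1) by (simp add: aff_dim_hyperplane)
  obtain B where B: "B \<subseteq> X" "\<not> affine_dependent B" "affine hull B = affine hull X" "of_nat(card B) = aff_dim X + 1"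
    using aff_dim_inner_basis_exists by metis
  then have "finite B" "card B \<le> 3" using \<open>aff_dim X \<le> 2\<close> aff_independent_finite by auto
  then have "coplanar B" by (rule coplanar_small)
  then have "coplanar (affine hull X)" using B(3) by (metis coplanar_affine_hull_coplanar)
  then show ?thesis by (simp add: coplanar_affine_hull_coplanar)
qed

section \<open>Hyperbolic circles and their orthogonality\<close>

text \<open>\<open>cosh\<close> inverts \<open>arcosh\<close> only from 1 upwards; the bound
  \<open>lor p x \<le> - 1\<close> places the argument there.\<close>

lemma hcircle_iff:
  assumes "p \<in> hyp" "r \<ge> 0"
  shows "x \<in> hcircle p r \<longleftrightarrow> x \<in> hyp \<and> lor p x = - cosh r"
proof (cases "x \<in> hyp")
  case True
  have "lor p x \<le> - 1"
    using lor_hyp_less [OF assms(1) True] hypD [OF True] by (cases "p = x") auto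
  then have "hdist p x = r \<longleftrightarrow> lor p x = - cosh r"
    using assms(2) arcosh_cosh_real [of r] cosh_arcosh_real [of "- lor p x"]
    by (auto simp: hdist_def)
  then show ?thesis using True by (simp add: hcircle_def)
qed (simp add: hcircle_def)

text \<open>The Lorentzian cross product; \<open>lcross x p\<close> is tangent at \<open>x\<close>
  to the circle about \<open>p\<close>.\<close>

definition lcross :: "real ^ 3 \<Rightarrow> real ^ 3 \<Rightarrow> real ^ 3" where
  "lcross x y = lflip (cross3 x y)"

lemma lor_lcross_self: "lor (lcross x y) x = 0" "lor (lcross x y) y = 0"
  by (simp_all add: lcross_def lflip_def lor_def cross3_simps)

text \<open>The Binet-Cauchy identity, with the sign opposite to the Euclidean one.\<close>

lemma lor_lcross_lcross:
  "lor (lcross x y) (lcross z w) = lor x w * lor y z - lor x z * lor y w"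
  by (simp add: lcross_def lflip_def lor_def cross3_simps)

text \<open>Hyperbolic Pythagoras: at a common point \<open>x\<close>, Binet-Cauchy and
  \<open>lor x x = - 1\<close> turn orthogonality of the tangents \<open>lcross x p\<close> and
  \<open>lcross x p'\<close> into this equation.\<close>

lemma lor_centres_if_orthogonal:
  assumes "p \<in> hyp" "p' \<in> hyp" "r \<ge> 0" "r' \<ge> 0" "orthogonal_circles p r p' r'"
  shows "lor p p' = - (cosh r * cosh r')"
proof -
  obtain x where x: "x \<in> hcircle p r" "x \<in> hcircle p' r'"
    using assms by (auto simp: orthogonal_circles_def)
  have "hcircle_tangent p x (lcross x p)" "hcircle_tangent p' x (lcross x p')"
    by (simp_all add: hcircle_tangent_def lor_lcross_self)
  then have "lor (lcross x p) (lcross x p') = 0"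
    using x assms(5) unfolding orthogonal_circles_def by blast
  moreover have "lor x x = - 1" "lor p x = - cosh r" "lor x p' = - cosh r'"
    using x assms hypD by (auto simp: hcircle_iff lor_commute)
  ultimately show ?thesis by (simp add: lor_lcross_lcross algebra_simps eq_neg_iff_add_eq_0)
qed

text \<open>Converse of hyperbolic Pythagoras. By \<open>pp\<close> the radial directions at a
  common point are orthogonal; in the two-dimensional tangent plane the tangent \<open>u\<close> of
  one circle is then parallel to the radius of the other.\<close>

lemma orthogonal_if_lor_centres:
  assumes "p \<in> hyp" "p' \<in> hyp" "r > 0" "r' > 0" and pp: "lor p p' = - (cosh r * cosh r')"
    and "hcircle p r \<inter> hcircle p' r' \<noteq> {}"
  shows "orthogonal_circles p r p' r'"
  unfolding orthogonal_circles_def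
proof (intro conjI ballI allI impI)
  fix x u u'
  assume "x \<in> hcircle p r \<inter> hcircle p' r'" and u: "hcircle_tangent p x u" and u': "hcircle_tangent p' x u'"
  then have x: "x \<in> hyp" "lor x x = -1" "lor p x = - cosh r" "lor p' x = - cosh r'"
    using assms hypD by (auto simp: hcircle_iff)
  \<comment> \<open>The components of the centres tangential at \<open>x\<close>, that is, the
    radial directions.\<close>
  define w where "w = p - cosh r *\<^sub>R x"
  define w' where "w' = p' - cosh r' *\<^sub>R x"
  have w: "lor w x = 0" "lor w' x = 0" "lor w' w = 0" "lor u w = 0" "lor u' w' = 0" "lor u x = 0" "lor u' x = 0"
    using pp u u' x lor_commute [of p p'] lor_commute [of x p] lor_commute [of x p']
    by (auto simp: w_def w'_def lor_simps hcircle_tangent_def)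
  \<comment> \<open>Positive radii enter here: a centre on the ray of \<open>x\<close> would force
    \<open>cosh s = 1\<close>.\<close>
  have nz: "z - cosh s *\<^sub>R x \<noteq> 0" if "z \<in> hyp" "s > 0" for z s
  proof
    assume "z - cosh s *\<^sub>R x = 0"
    then have "z = cosh s *\<^sub>R x" by simp
    then have "lor z z = - (cosh s * cosh s)" using x by (simp add: lor_simps)
    then have "(cosh s)\<^sup>2 = 1" using hypD [OF that(1)] by (simp add: power2_eq_square)
    then have "cosh s = 1" using cosh_real_ge_1 [of s] by (simp add: power2_eq_1_iff)
    then show False using that by simp
  qed
  have "w \<noteq> 0" "w' \<noteq> 0" unfolding w_def w'_def using nz assms by auto
  then obtain m where "u = m *\<^sub>R w'"
    using parallel_if_lor_orthogonal [of x w w' u] x w by auto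
  then show "lor u u' = 0" using w by (simp add: lor_simps lor_commute)
qed (use assms in auto)

section \<open>Radial projection and orientation of triples\<close>

lemma proj_hyp:
  assumes "lor k k < 0" "k $ 3 > 0"
  shows "proj k \<in> hyp" "lnorm k > 0" "k = lnorm k *\<^sub>R proj k" "(lnorm k)\<^sup>2 = - lor k k"
proof -
  show l: "lnorm k > 0" using assms by (simp add: lnorm_def)
  show l2: "(lnorm k)\<^sup>2 = - lor k k"
    using assms by (simp add: lnorm_def power2_eq_square real_sqrt_mult_self)
  show "k = lnorm k *\<^sub>R proj k" using l by (simp add: proj_def)
  show "proj k \<in> hyp"
    using l l2 assms by (simp add: hyp_def proj_def lor_simps power2_eq_square field_simps)
qed

lemma lnorm_scaleR_hyp:
  assumes "x \<in> hyp" "c > 0"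
  shows "lnorm (c *\<^sub>R x) = c" "proj (c *\<^sub>R x) = x"
proof -
  have "lor (c *\<^sub>R x) (c *\<^sub>R x) = - c\<^sup>2" using hypD [OF assms(1)] by (simp add: lor_simps power2_eq_square)
  then show "lnorm (c *\<^sub>R x) = c" using assms(2) by (simp add: lnorm_def real_sqrt_minus)
  then show "proj (c *\<^sub>R x) = x" using assms(2) by (simp add: proj_def)
qed

lemma rotates_scaleR:
  assumes "c > 0" "d > 0" "e > 0"
  shows "rotates \<sigma> (c *\<^sub>R p) (d *\<^sub>R x) (e *\<^sub>R y) \<longleftrightarrow> rotates \<sigma> p x y"
proof -
  have "det (vector [c *\<^sub>R p, d *\<^sub>R x, e *\<^sub>R y] :: real ^ 3 ^ 3) = (c * d * e) * det (vector [p, x, y] :: real ^ 3 ^ 3)"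
    by (simp add: det_3 algebra_simps)
  then have "\<sigma> * det (vector [c *\<^sub>R p, d *\<^sub>R x, e *\<^sub>R y] :: real ^ 3 ^ 3)
      = (c * d * e) * (\<sigma> * det (vector [p, x, y] :: real ^ 3 ^ 3))" by simp
  moreover have "c * d * e > 0" using assms by simp
  ultimately show ?thesis unfolding rotates_def by (metis zero_less_mult_pos mult_pos_pos)
qed

text \<open>A determinant with two proportional rows vanishes. This is how regularity will exclude
  rings of inner radius 0.\<close>

lemma rotates_imp_not_parallel:
  assumes "rotates \<sigma> p x y" shows "p \<noteq> c *\<^sub>R x" "p \<noteq> c *\<^sub>R y"
  using assms by (auto simp: rotates_def det_3 algebra_simps)

lemma not_rotates_both: "\<not> (rotates 1 p x y \<and> rotates (-1) p x y)"
  by (simp add: rotates_def)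

text \<open>Each alternative of \<open>cyclic3\<close> names two of the three arcs, so alternatives
  for the two senses share an arc, whose determinant would have both signs.\<close>

lemma not_cyclic3_both: "\<not> (cyclic3 1 p x y z \<and> cyclic3 (-1) p x y z)"
  by (auto simp: cyclic3_def rotates_def)

lemma cyclic3_imp_not_parallel:
  assumes "cyclic3 \<sigma> p x y z" shows "p \<noteq> c *\<^sub>R x" "p \<noteq> c *\<^sub>R y" "p \<noteq> c *\<^sub>R z"
  using assms rotates_imp_not_parallel [of \<sigma> p] unfolding cyclic3_def by blast+

section \<open>Combinatorics of S-quad graphs\<close>

abbreviation star :: "'v squad \<Rightarrow> 'v \<Rightarrow> 'v list \<Rightarrow> bool" where
  "star S v xs \<equiv> boundary_star S v xs \<or> interior_star S v xs"

abbreviation white :: "'v squad \<Rightarrow> 'v set" where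
  "white S \<equiv> Vs S \<union> Vc S"

locale squad_graph =
  fixes S :: "'v squad"
  assumes s_quad_graph: "s_quad_graph S"
begin

lemma disjoint_classes:
  "v \<in> Vs S \<Longrightarrow> v \<notin> Vc S" "v \<in> Vs S \<Longrightarrow> v \<notin> Vb S" "v \<in> Vc S \<Longrightarrow> v \<notin> Vb S"
  using s_quad_graph unfolding s_quad_graph_def by blast+

lemma quadD:
  assumes "(s, b, c, b') \<in> quads S"
  shows "s \<in> Vs S" "b \<in> Vb S" "c \<in> Vc S" "b' \<in> Vb S" "hor S b \<longleftrightarrow> \<not> hor S b'"
  using s_quad_graph assms unfolding s_quad_graph_def by blast+

lemma quad_adj:
  assumes "(s, b, c, b') \<in> quads S"
  shows "adj S s b" "adj S s b'" "adj S c b" "adj S c b'" "adj S b s" "adj S b c" "adj S b' s" "adj S b' c"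
  using assms unfolding adj_def turn_def by blast+

lemma star_exists: "v \<in> white S \<union> Vb S \<Longrightarrow> \<exists>xs. star S v xs"
  using s_quad_graph unfolding s_quad_graph_def by blast

lemma star_length:
  assumes "v \<in> white S \<union> Vb S" "star S v xs"
  shows "length xs \<ge> 2"
proof -
  have "length xs \<noteq> 1 \<and> length xs \<noteq> 0" if "interior_star S v xs"
  proof -
    have "even (length xs)" using s_quad_graph assms that unfolding s_quad_graph_def by blast
    moreover have "length xs \<noteq> 0" using that by (simp add: interior_star_def)
    ultimately show ?thesis by auto
  qed
  moreover have "n \<ge> 2" if "n \<noteq> 1 \<and> n \<noteq> 0" for n :: nat using that by linarith
  ultimately show ?thesis using assms(2) unfolding boundary_star_def by blast
qed

lemma star_turn:
  assumes "star S v xs" and i: "Suc i < length xs"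
  shows "turn S v (xs ! i) (xs ! Suc i)"
  using assms(1)
proof
  assume "boundary_star S v xs"
  then show ?thesis using i unfolding boundary_star_def by blast
next
  assume "interior_star S v xs"
  then have "turn S v (xs ! i) (xs ! (Suc i mod length xs))"
    using Suc_lessD [OF i] unfolding interior_star_def by blast
  then show ?thesis using i by simp
qed

lemma star_set:
  assumes "v \<in> white S \<union> Vb S" "star S v xs"
  shows "set xs = {x. adj S v x}"
proof (intro equalityI subsetI)
  fix x assume "x \<in> set xs"
  then obtain i where i: "i < length xs" "x = xs ! i" by (auto simp: in_set_conv_nth)
  \<comment> \<open>The first entry opens a corner and every later one closes a corner; the last
    entry of a boundary star opens none.\<close>
  have "\<exists>y. turn S v x y \<or> turn S v y x"
  proof (cases i)
    case 0
    then show ?thesis using star_turn [OF assms(2), of 0] star_length [OF assms] i by auto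
  next
    case (Suc j)
    then show ?thesis using star_turn [OF assms(2), of j] i by auto
  qed
  then show "x \<in> {x. adj S v x}" by (simp add: adj_def)
next
  fix x assume "x \<in> {x. adj S v x}"
  then obtain y where "turn S v x y \<or> turn S v y x" by (auto simp: adj_def)
  moreover have "z \<in> set xs \<and> w \<in> set xs" if zw: "turn S v z w" for z w
    using assms(2)
  proof
    assume "boundary_star S v xs"
    then obtain i where "Suc i < length xs" "z = xs ! i" "w = xs ! Suc i"
      using zw unfolding boundary_star_def by blast
    then show ?thesis by simp
  next
    assume "interior_star S v xs"
    then obtain i where "i < length xs" "z = xs ! i" "w = xs ! (Suc i mod length xs)"
      using zw unfolding interior_star_def by blast
    moreover from this have "Suc i mod length xs < length xs" by (intro mod_less_divisor) auto
    ultimately show ?thesis by simp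
  qed
  ultimately show "x \<in> set xs" by blast
qed

lemma turn_exists: "v \<in> white S \<union> Vb S \<Longrightarrow> \<exists>x y. turn S v x y"
proof -
  assume v: "v \<in> white S \<union> Vb S"
  obtain xs where xs: "star S v xs" using star_exists [OF v] by blast
  then have "turn S v (xs ! 0) (xs ! Suc 0)" using star_length [OF v xs] by (intro star_turn) auto
  then show ?thesis by blast
qed

lemma turn_whiteD:
  assumes "v \<in> white S" "turn S v x y"
  shows "x \<in> Vb S" "y \<in> Vb S" "hor S x \<longleftrightarrow> \<not> hor S y"
proof -
  obtain s b c b' where q: "(s, b, c, b') \<in> quads S" and
    v: "v = s \<and> x = b \<and> y = b' \<or> v = b \<and> x = c \<and> y = s \<or>
      v = c \<and> x = b' \<and> y = b \<or> v = b' \<and> x = s \<and> y = c"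
    using assms unfolding turn_def by blast
  \<comment> \<open>\<open>turn\<close> covers all four corners of a quad; disjointness of the
    vertex classes leaves the two at white vertices.\<close>
  have "v \<noteq> b" "v \<noteq> b'" using quadD [OF q] disjoint_classes assms(1) by blast+
  then have "x = b \<and> y = b' \<or> x = b' \<and> y = b" using v by blast
  then show "x \<in> Vb S" "y \<in> Vb S" "hor S x \<longleftrightarrow> \<not> hor S y"
    using quadD [OF q] by auto
qed

lemma turn_blackE:
  assumes "b \<in> Vb S" "turn S b x y"
  obtains s c b' where "(s, b, c, b') \<in> quads S \<or> (s, b', c, b) \<in> quads S" "x = s \<and> y = c \<or> x = c \<and> y = s"
proof -
  obtain s d c d' where q: "(s, d, c, d') \<in> quads S" and
    v: "b = s \<and> x = d \<and> y = d' \<or> b = d \<and> x = c \<and> y = s \<or>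
      b = c \<and> x = d' \<and> y = d \<or> b = d' \<and> x = s \<and> y = c"
    using assms unfolding turn_def by blast
  have "b \<noteq> s" "b \<noteq> c" using quadD [OF q] disjoint_classes assms(1) by blast+
  then show ?thesis using q v that by blast
qed

lemma adj_whiteD: "v \<in> white S \<Longrightarrow> adj S v b \<Longrightarrow> b \<in> Vb S"
  unfolding adj_def using turn_whiteD by blast

lemma adj_sym: "adj S v x \<longleftrightarrow> adj S x v"
  unfolding adj_def turn_def by blast

lemma black_quad: "b \<in> Vb S \<Longrightarrow> \<exists>s c b'. (s, b, c, b') \<in> quads S \<or> (s, b', c, b) \<in> quads S"
  by (meson turn_exists turn_blackE UnI2)

text \<open>Colours alternate across any corner at \<open>v\<close>. The neighbour obtained supplies
  a touching point on the inner circle.\<close>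

lemma white_horizontal:
  assumes "v \<in> white S"
  shows "\<exists>b. adj S v b \<and> horizontal S v b"
proof -
  obtain x y where t: "turn S v x y" using turn_exists assms by blast
  then have "adj S v x" "adj S v y" by (auto simp: adj_def)
  then show ?thesis using turn_whiteD [OF assms t] by (auto simp: horizontal_def)
qed

lemma opposite_Vs: "v \<in> Vs S \<Longrightarrow> opposite S v w \<longleftrightarrow> (\<exists>b b'. (v, b, w, b') \<in> quads S)"
  unfolding opposite_def by (metis quadD(1,3) disjoint_classes(1))

lemma opposite_Vc: "v \<in> Vc S \<Longrightarrow> opposite S v w \<longleftrightarrow> (\<exists>b b'. (w, b, v, b') \<in> quads S)"
  unfolding opposite_def by (metis quadD(1,3) disjoint_classes(1))

section \<open>Cyclic order around a white vertex\<close>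

text \<open>Orientation depends on rays only. This transfers regularity from net vertices and points
  of tangency to ring centres and touching points, and back.\<close>

lemma ordered_around_scaleR:
  assumes v: "v \<in> white S" and "d > 0"
    and f: "\<And>b. adj S v b \<Longrightarrow> \<exists>c>0. f' b = c *\<^sub>R f b"
  shows "ordered_around S \<sigma> (d *\<^sub>R p) f' v \<longleftrightarrow> ordered_around S \<sigma> p f v"
proof -
  have rot: "rotates \<sigma> (d *\<^sub>R p) (f' x) (f' y) \<longleftrightarrow> rotates \<sigma> p (f x) (f y)"
    if "adj S v x" "adj S v y" for x y
    using f [OF that(1)] f [OF that(2)] rotates_scaleR \<open>d > 0\<close> by metis
  have cyc: "cyclic3 \<sigma> (d *\<^sub>R p) (f' (xs ! i)) (f' (xs ! j)) (f' (xs ! k))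
      \<longleftrightarrow> cyclic3 \<sigma> p (f (xs ! i)) (f (xs ! j)) (f (xs ! k))"
    if "star S v xs" "i < j \<and> j < k \<and> k < length xs" for xs i j k
  proof -
    have "adj S v (xs ! i)" "adj S v (xs ! j)" "adj S v (xs ! k)"
      using star_set [OF UnI1 [OF v] that(1)] that(2) nth_mem [of _ xs] by auto
    then show ?thesis by (simp add: cyclic3_def rot)
  qed
  have two: "rotates \<sigma> (d *\<^sub>R p) (f' b) (f' b') \<longleftrightarrow> rotates \<sigma> p (f b) (f b')" if "turn S v b b'" for b b'
    using rot that by (auto simp: adj_def)
  have "(\<forall>i j k. i < j \<and> j < k \<and> k < length xs \<longrightarrow>
          cyclic3 \<sigma> (d *\<^sub>R p) (f' (xs ! i)) (f' (xs ! j)) (f' (xs ! k))) \<longleftrightarrow>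
        (\<forall>i j k. i < j \<and> j < k \<and> k < length xs \<longrightarrow>
          cyclic3 \<sigma> p (f (xs ! i)) (f (xs ! j)) (f (xs ! k)))" if "star S v xs" for xs
    using cyc [OF that] by blast
  moreover have "(\<forall>b b'. turn S v b b' \<longrightarrow> rotates \<sigma> (d *\<^sub>R p) (f' b) (f' b')) \<longleftrightarrow>
      (\<forall>b b'. turn S v b b' \<longrightarrow> rotates \<sigma> p (f b) (f b'))"
    using two by blast
  ultimately show ?thesis unfolding ordered_around_def by simp
qed

text \<open>Every neighbour takes part in some order condition: in the corner condition if there are
  two neighbours, otherwise in a triple.\<close>

lemma ordered_around_not_parallel:
  assumes v: "v \<in> white S" and o: "ordered_around S \<sigma> p f v" and b: "adj S v b"
  shows "p \<noteq> c *\<^sub>R f b"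
proof -
  obtain xs where xs: "star S v xs" using star_exists v by blast
  then obtain i where i: "i < length xs" "b = xs ! i"
    using star_set v b by (metis UnCI in_set_conv_nth mem_Collect_eq)
  show ?thesis
  proof (cases "length xs = 2")
    case True
    then show ?thesis using o xs b rotates_imp_not_parallel unfolding ordered_around_def adj_def by metis
  next
    case False
    then have "2 < length xs" using star_length [OF UnI1 [OF v] xs] by simp
    \<comment> \<open>Positions 0 and 1 are covered by the triple (0, 1, 2), a later position
      \<open>i\<close> by (0, 1, \<open>i\<close>).\<close>
    then have c: "cyclic3 \<sigma> p (f (xs ! 0)) (f (xs ! 1)) (f (xs ! 2))"
      "1 < i \<Longrightarrow> cyclic3 \<sigma> p (f (xs ! 0)) (f (xs ! 1)) (f (xs ! i))"
      using o xs i unfolding ordered_around_def by auto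
    consider "i = 0" | "i = 1" | "1 < i" by linarith
    then show ?thesis using cyclic3_imp_not_parallel c i by cases metis+
  qed
qed

text \<open>This makes the orientation, hence the sign of the inner radius, a function of the
  configuration.\<close>

lemma ordered_around_unique:
  assumes v: "v \<in> white S"
  shows "\<not> (ordered_around S 1 p f v \<and> ordered_around S (- 1) p f v)"
proof
  assume o: "ordered_around S 1 p f v \<and> ordered_around S (- 1) p f v"
  obtain xs where xs: "star S v xs" using star_exists v by blast
  show False
  proof (cases "length xs = 2")
    case True
    obtain x y where "turn S v x y" using turn_exists v by blast
    then show ?thesis using o xs True not_rotates_both unfolding ordered_around_def by metis
  next
    case False
    then have "2 < length xs" using star_length [OF UnI1 [OF v] xs] by simp
    then have "cyclic3 \<sigma> p (f (xs ! 0)) (f (xs ! 1)) (f (xs ! 2))" if "\<sigma> = 1 \<or> \<sigma> = -1" for \<sigma>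
      using o xs that unfolding ordered_around_def by auto
    then show ?thesis using not_cyclic3_both by blast
  qed
qed

end

section \<open>Configurations and the maps to both sides\<close>

text \<open>The radius of the sphere touched: \<open>a\<close> stands for |r_-| (horizontal edges)
  and \<open>1 / a\<close> for |r_+|.\<close>

definition rad :: "real \<Rightarrow> bool \<Rightarrow> real" where
  "rad a h = (if h then a else 1 / a)"

lemma rad_pos: "0 < a \<Longrightarrow> 0 < rad a h"
  by (simp add: rad_def)

lemma rad_mult_not: "0 < a \<Longrightarrow> rad a h * rad a (\<not> h) = 1" "0 < a \<Longrightarrow> rad a (\<not> h) * rad a h = 1"
  by (simp_all add: rad_def)

lemma upper_sphere_iff:
  assumes "0 < r"
  shows "t \<in> upper_sphere (- r\<^sup>2) \<longleftrightarrow> (\<exists>x \<in> hyp. t = r *\<^sub>R x)"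
proof
  assume t: "t \<in> upper_sphere (- r\<^sup>2)"
  then have "lor t t < 0" "t $ 3 > 0" "lor t t = - r\<^sup>2" using assms by (auto simp: upper_sphere_def)
  with proj_hyp [OF this(1,2)] have "proj t \<in> hyp" "lnorm t = r" "t = lnorm t *\<^sub>R proj t"
    using assms by (auto simp: power2_eq_iff_nonneg)
  then show "\<exists>x \<in> hyp. t = r *\<^sub>R x" by metis
next
  assume "\<exists>x \<in> hyp. t = r *\<^sub>R x"
  then show "t \<in> upper_sphere (- r\<^sup>2)"
    using assms by (auto simp: upper_sphere_def hyp_def lor_simps power2_eq_square)
qed

text \<open>
  The common core of both sides: a Koebe pair with its points of tangency moved to the unit
  hyperboloid along their rays.
\<close>

definition configurations :: "'v squad \<Rightarrow> real \<Rightarrow> (('v \<Rightarrow> real ^ 3) \<times> ('v \<Rightarrow> real ^ 3)) set" where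
  "configurations S a = {(K, q). K \<in> extensional (white S) \<and> q \<in> extensional (Vb S) \<and>
     (\<forall>b \<in> Vb S. q b \<in> hyp) \<and>
     (\<forall>v \<in> white S. lor (K v) (K v) < 0 \<and>
        (\<forall>b. adj S v b \<longrightarrow> lor (K v) (q b) = - rad a (horizontal S v b)) \<and>
        (ordered_around S 1 (K v) q v \<or> ordered_around S (- 1) (K v) q v)) \<and>
     (\<forall>(s, b, c, b') \<in> quads S. lor (K s) (K c) = - 1)}"

lemma configurationsD:
  assumes "(K, q) \<in> configurations S a"
  shows "K \<in> extensional (white S)" "q \<in> extensional (Vb S)"
    "b \<in> Vb S \<Longrightarrow> q b \<in> hyp"
    "v \<in> white S \<Longrightarrow> lor (K v) (K v) < 0"
    "v \<in> white S \<Longrightarrow> adj S v b \<Longrightarrow> lor (K v) (q b) = - rad a (horizontal S v b)"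
    "v \<in> white S \<Longrightarrow> ordered_around S 1 (K v) q v \<or> ordered_around S (- 1) (K v) q v"
    "(s, b, c, b') \<in> quads S \<Longrightarrow> lor (K s) (K c) = - 1"
  using assms unfolding configurations_def by blast+

text \<open>In a dual pair both nets give the same projected points of tangency; those of the first
  are taken. Restriction makes the maps extensional, so that they are determined by their relevant
  values.\<close>

definition config_of_koebe ::
    "'v squad \<Rightarrow> 'v net \<times> 'v net \<Rightarrow> ('v \<Rightarrow> real ^ 3) \<times> ('v \<Rightarrow> real ^ 3)" where
  "config_of_koebe S N =
     (\<lambda>v \<in> white S. if v \<in> Vs S then fst (fst N) v else fst (snd N) v,
      \<lambda>b \<in> Vb S. proj (snd (fst N) b))"

text \<open>The dual edge has the opposite colour, hence the negated flag and the other
  sphere.\<close>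

definition koebe_of_config ::
    "'v squad \<Rightarrow> real \<Rightarrow> ('v \<Rightarrow> real ^ 3) \<times> ('v \<Rightarrow> real ^ 3) \<Rightarrow> 'v net \<times> 'v net" where
  "koebe_of_config S a X =
     ((restrict (fst X) (Vs S), \<lambda>b \<in> Vb S. rad a (hor S b) *\<^sub>R snd X b),
      (restrict (fst X) (Vc S), \<lambda>b \<in> Vb S. rad a (\<not> hor S b) *\<^sub>R snd X b))"

text \<open>The sense of the cyclic order becomes the sign of the inner radius; on configurations
  the second branch is the clockwise case.\<close>

definition rings_of_config ::
    "'v squad \<Rightarrow> real \<Rightarrow> ('v \<Rightarrow> real ^ 3) \<times> ('v \<Rightarrow> real ^ 3) \<Rightarrow> ('v \<Rightarrow> hring) \<times> ('v \<Rightarrow> real ^ 3)" where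
  "rings_of_config S a X =
     (\<lambda>v \<in> white S. \<lparr>ctr = proj (fst X v),
        inr = (if ordered_around S 1 (fst X v) (snd X) v then 1 else - 1) * arcosh (a / lnorm (fst X v)),
        outr = arcosh (1 / a / lnorm (fst X v))\<rparr>, snd X)"

text \<open>Solves \<open>cosh R = 1 / (a * lnorm (K v))\<close> for the length of the vertex vector
  on the ray of the centre.\<close>

definition config_of_rings ::
    "'v squad \<Rightarrow> real \<Rightarrow> ('v \<Rightarrow> hring) \<times> ('v \<Rightarrow> real ^ 3) \<Rightarrow> ('v \<Rightarrow> real ^ 3) \<times> ('v \<Rightarrow> real ^ 3)" where
  "config_of_rings S a P =
     (\<lambda>v \<in> white S. (1 / (a * cosh (outr (fst P v)))) *\<^sub>R ctr (fst P v), snd P)"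

section \<open>Koebe pairs and configurations\<close>

context squad_graph
begin

lemma horizontal_simps:
  "v \<in> Vs S \<Longrightarrow> horizontal S v b \<longleftrightarrow> hor S b"
  "v \<in> Vc S \<Longrightarrow> horizontal S v b \<longleftrightarrow> \<not> hor S b"
  using disjoint_classes by (auto simp: horizontal_def)

text \<open>
  Around a black vertex, possibly of large degree at the boundary, consecutive directions are
  orthogonal in the plane orthogonal to \<open>x\<close>; hence they alternate between two fixed lines.
\<close>

lemma alternating_directions:
  assumes b: "b \<in> Vb S" and x: "lor x x < 0"
    and D: "\<And>v. adj S v b \<Longrightarrow> D v \<noteq> 0" "\<And>v. adj S v b \<Longrightarrow> lor (D v) x = 0"
    and orth: "\<And>s c b'. (s, b, c, b') \<in> quads S \<or> (s, b', c, b) \<in> quads S \<Longrightarrow> lor (D s) (D c) = 0"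
  shows "\<exists>e e'. lor e e' = 0 \<and> (\<forall>v \<in> Vs S. adj S v b \<longrightarrow> (\<exists>m. D v = m *\<^sub>R e)) \<and>
    (\<forall>v \<in> Vc S. adj S v b \<longrightarrow> (\<exists>m. D v = m *\<^sub>R e'))"
proof -
  obtain xs where xs: "star S b xs" using star_exists b by blast
  have len: "2 \<le> length xs" using star_length xs b by blast
  have set: "set xs = {v. adj S b v}" using star_set xs b by blast
  have "turn S b (xs ! 0) (xs ! Suc 0)" using star_turn [OF xs] len by simp
  then obtain s\<^sub>0 c\<^sub>0 b\<^sub>0 where q0: "(s\<^sub>0, b, c\<^sub>0, b\<^sub>0) \<in> quads S \<or> (s\<^sub>0, b\<^sub>0, c\<^sub>0, b) \<in> quads S"
    and start: "xs ! 0 = s\<^sub>0 \<or> xs ! 0 = c\<^sub>0"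
    by (rule turn_blackE [OF b]) blast
  have sc0: "s\<^sub>0 \<in> Vs S" "c\<^sub>0 \<in> Vc S" using q0 quadD by blast+
  then have nsc0: "s\<^sub>0 \<notin> Vc S" "c\<^sub>0 \<notin> Vs S" using disjoint_classes by blast+
  have ad0: "adj S s\<^sub>0 b" "adj S c\<^sub>0 b" using q0 quad_adj by blast+
  note D0 = D(1) [OF ad0(1)] D(1) [OF ad0(2)] D(2) [OF ad0(1)] D(2) [OF ad0(2)]
  note orth0 = orth [OF q0]
  \<comment> \<open>One step across a corner: the plane orthogonal to \<open>x\<close> is
    two-dimensional, so a direction orthogonal to \<open>f\<close> lies on the line of
    \<open>f'\<close>.\<close>
  have turn_direction: "\<exists>m. D w = m *\<^sub>R f'"
    if v: "adj S v b" and w: "adj S w b" and "lor (D v) (D w) = 0" and mf: "\<exists>m. D v = m *\<^sub>R f"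
      and f: "lor f x = 0" "f \<noteq> 0" "lor f' x = 0" "f' \<noteq> 0" "lor f' f = 0" for v w f f'
  proof -
    obtain m where m: "D v = m *\<^sub>R f" using mf by blast
    with D(1) [OF v] have "m \<noteq> 0" by auto
    then have "lor f (D w) = 0" using \<open>lor (D v) (D w) = 0\<close> by (simp add: m lor_simps)
    then have "lor (D w) f = 0" by (simp add: lor_commute)
    then show ?thesis by (rule parallel_if_lor_orthogonal [OF x f(1,2,3,5,4) D(2) [OF w]])
  qed
  \<comment> \<open>The invariant refers to labels instead of parities of positions, so a turn
    preserves it whichever label comes first.\<close>
  define P where "P v \<longleftrightarrow> (v \<in> Vs S \<longrightarrow> (\<exists>m. D v = m *\<^sub>R D s\<^sub>0)) \<and> (v \<in> Vc S \<longrightarrow> (\<exists>m. D v = m *\<^sub>R D c\<^sub>0))" for v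
  have step: "P w" if v: "P v" and t: "turn S b v w" for v w
  proof -
    obtain s c b' where q: "(s, b, c, b') \<in> quads S \<or> (s, b', c, b) \<in> quads S"
      and vw: "v = s \<and> w = c \<or> v = c \<and> w = s"
      by (rule turn_blackE [OF b t]) blast
    have sc: "s \<in> Vs S" "c \<in> Vc S" using q quadD by blast+
    then have nsc: "s \<notin> Vc S" "c \<notin> Vs S" using disjoint_classes by blast+
    have ad: "adj S s b" "adj S c b" using q quad_adj by blast+
    have o: "lor (D s) (D c) = 0" "lor (D c) (D s) = 0" using orth [OF q] by (simp_all add: lor_commute)
    show ?thesis using vw
    proof
      assume vw: "v = s \<and> w = c"
      then have "\<exists>m. D s = m *\<^sub>R D s\<^sub>0" using v sc unfolding P_def by blast
      then have "\<exists>m. D c = m *\<^sub>R D c\<^sub>0"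
        by (rule turn_direction [OF ad o(1)]) (use D0 orth0 in \<open>simp_all add: lor_commute\<close>)
      then show ?thesis using vw nsc by (simp add: P_def)
    next
      assume vw: "v = c \<and> w = s"
      then have "\<exists>m. D c = m *\<^sub>R D c\<^sub>0" using v sc unfolding P_def by blast
      then have "\<exists>m. D s = m *\<^sub>R D s\<^sub>0"
        by (rule turn_direction [OF ad(2,1) o(2)]) (use D0 orth0 in \<open>simp_all\<close>)
      then show ?thesis using vw nsc by (simp add: P_def)
    qed
  qed
  have "\<exists>m. y = m *\<^sub>R y" for y :: "real ^ 3" by (rule exI [of _ 1]) simp
  \<comment> \<open>The star may begin with either label; both reference vertices lie on its first
    corner.\<close>
  then have P0: "P (xs ! 0)" using start nsc0 unfolding P_def by metis
  have "P (xs ! i)" if "i < length xs" for i using that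
  proof (induction i)
    case 0
    show ?case by (rule P0)
  next
    case (Suc i)
    show ?case by (rule step [OF Suc.IH [OF Suc_lessD [OF Suc.prems]] star_turn [OF xs Suc.prems]])
  qed
  then have "P v" if "adj S v b" for v
    using that set adj_sym [of v b] by (metis in_set_conv_nth mem_Collect_eq)
  then show ?thesis using orth0 unfolding P_def by blast
qed

text \<open>Regularity in the form needed on both sides: it keeps the edge vectors of the nets and
  the inner radii of the rings nonzero.\<close>

lemma config_not_parallel:
  assumes "(K, q) \<in> configurations S a" "v \<in> white S" "adj S v b"
  shows "K v \<noteq> m *\<^sub>R q b"
  using configurationsD(6) [OF assms(1,2)] ordered_around_not_parallel assms(2,3) by blast

text \<open>Tangency fixes the products with \<open>q\<close>. A vertex of the dual net has constant
  product with the points of its face, and evaluation at a point of tangency gives the quad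
  equation.\<close>

lemma config_of_koebe:
  assumes a: "0 < a" and N: "((ks, ts), (kc, tc)) \<in> koebe_pairs S (- (1 / a)\<^sup>2) (- a\<^sup>2)"
  shows "config_of_koebe S ((ks, ts), (kc, tc)) \<in> configurations S a"
    and "koebe_of_config S a (config_of_koebe S ((ks, ts), (kc, tc))) = ((ks, ts), (kc, tc))"
    and "b \<in> Vb S \<Longrightarrow> proj (ts b) = proj (tc b)"
proof -
  have ns: "koebe_net S (Vs S) (Vc S) {b \<in> Vb S. hor S b} (- (1 / a)\<^sup>2) (- a\<^sup>2) (ks, ts)"
    and nc: "koebe_net S (Vc S) (Vs S) {b \<in> Vb S. \<not> hor S b} (- (1 / a)\<^sup>2) (- a\<^sup>2) (kc, tc)"
    and normal: "\<And>c x y. c \<in> Vc S \<Longrightarrow> x \<in> face_points S (ks, ts) c \<Longrightarrow> y \<in> face_points S (ks, ts) c \<Longrightarrow> lor (kc c) (x - y) = 0"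
    and pp: "\<And>b. b \<in> Vb S \<Longrightarrow> proj (ts b) = proj (tc b)"
    and rs: "regular_net S (Vs S) (ks, ts)" and rc: "regular_net S (Vc S) (kc, tc)"
    and time: "\<And>s. s \<in> Vs S \<Longrightarrow> lor (ks s) (ks s) < 0" "\<And>c. c \<in> Vc S \<Longrightarrow> lor (kc c) (kc c) < 0"
    using N unfolding koebe_pairs_def dual_nets_def by simp_all
  show "b \<in> Vb S \<Longrightarrow> proj (ts b) = proj (tc b)" by (rule pp)
  define q where "q = (\<lambda>b \<in> Vb S. proj (ts b))"
  define K where "K = (\<lambda>v \<in> white S. if v \<in> Vs S then ks v else kc v)"
  have Ks: "K v = ks v" if "v \<in> Vs S" for v using that by (simp add: K_def)
  have Kc: "K v = kc v" if "v \<in> Vc S" for v using that disjoint_classes by (auto simp: K_def)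
  \<comment> \<open>Both points of tangency are scaled points of the hyperboloid; equality of
    projections makes these one point.\<close>
  have q: "ts b = rad a (hor S b) *\<^sub>R q b \<and> tc b = rad a (\<not> hor S b) *\<^sub>R q b \<and> q b \<in> hyp"
    if b: "b \<in> Vb S" for b
  proof -
    have "ts b \<in> upper_sphere (- (rad a (hor S b))\<^sup>2)" "tc b \<in> upper_sphere (- (rad a (\<not> hor S b))\<^sup>2)"
      using ns nc b by (auto simp: koebe_net_def rad_def)
    then obtain x y where "x \<in> hyp" "ts b = rad a (hor S b) *\<^sub>R x" "y \<in> hyp" "tc b = rad a (\<not> hor S b) *\<^sub>R y"
      using a by (auto simp: upper_sphere_iff rad_pos)
    moreover from this have "proj (ts b) = x" "proj (tc b) = y"
      using lnorm_scaleR_hyp rad_pos [OF a] by metis+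
    ultimately show ?thesis using pp [OF b] b by (simp add: q_def)
  qed
  \<comment> \<open>Tangency reads \<open>r * (lor k (q b) + r) = 0\<close>, because
    \<open>lor (q b) (q b) = - 1\<close>.\<close>
  have tangent: "lor k (q b) = - r"
    if "lor (k - r *\<^sub>R q b) (r *\<^sub>R q b) = 0" "b \<in> Vb S" "r > 0" for k b r
  proof -
    have "r * (lor k (q b) + r) = 0"
      using that q [OF that(2)] hypD(1) [of "q b"] by (simp add: lor_simps algebra_simps)
    then show ?thesis using that by simp
  qed
  have touch: "lor (K v) (q b) = - rad a (horizontal S v b)" if v: "v \<in> white S" and ad: "adj S v b" for v b
  proof -
    have b: "b \<in> Vb S" using adj_whiteD v ad by blast
    show ?thesis
    proof (cases "v \<in> Vs S")
      case True
      then have "lor (ks v - ts b) (ts b) = 0"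
        using ns b ad by (auto simp: koebe_net_def edge_points_def)
      then show ?thesis using True tangent [OF _ b] rad_pos [OF a] q [OF b] by (simp add: Ks horizontal_simps)
    next
      case False
      then have c: "v \<in> Vc S" using v by blast
      then have "lor (kc v - tc b) (tc b) = 0"
        using nc b ad by (auto simp: koebe_net_def edge_points_def)
      then show ?thesis using c tangent [OF _ b] rad_pos [OF a] q [OF b] by (simp add: Kc horizontal_simps)
    qed
  qed
  have quad: "lor (K s) (K c) = - 1" if Q: "(s, b, c, b') \<in> quads S" for s b c b'
  proof -
    note v = quadD [OF Q]
    have "opposite S c s" using opposite_Vc [OF v(3)] Q by blast
    then have "ks s \<in> face_points S (ks, ts) c" "ts b \<in> face_points S (ks, ts) c"
      using quad_adj(3) [OF Q] by (simp_all add: face_points_def)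
    \<comment> \<open>The normal has the same product with \<open>ks s\<close> and
      \<open>ts b\<close>; the latter is minus the product of two reciprocal radii.\<close>
    from normal [OF v(3) this] have "lor (kc c) (ks s) = lor (kc c) (ts b)"
      by (simp add: lor_simps)
    also have "\<dots> = rad a (hor S b) * lor (K c) (q b)"
      using q [OF v(2)] v(3) by (simp add: Kc lor_simps)
    also have "\<dots> = - 1"
      using touch [OF UnI2 [OF v(3)] quad_adj(3) [OF Q]] rad_mult_not(1) [OF a]
      by (simp add: horizontal_simps(2) [OF v(3)])
    finally show ?thesis by (simp add: Ks [OF v(1)] Kc [OF v(3)] lor_commute [of "ks s"])
  qed
  have ord: "ordered_around S \<sigma> (K v) q v" if v: "v \<in> white S"
    and o: "ordered_around S \<sigma> (K v) (if v \<in> Vs S then ts else tc) v" for v \<sigma>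
  proof -
    have "\<exists>c>0. (if v \<in> Vs S then ts else tc) b = c *\<^sub>R q b" if "adj S v b" for b
      using q [OF adj_whiteD [OF v that]] rad_pos [OF a] by auto
    from ordered_around_scaleR [OF v zero_less_one this, where \<sigma> = \<sigma> and p = "K v"] o show ?thesis by simp
  qed
  have ord: "ordered_around S 1 (K v) q v \<or> ordered_around S (- 1) (K v) q v" if v: "v \<in> white S" for v
  proof (cases "v \<in> Vs S")
    case True
    then have "ordered_around S 1 (K v) ts v \<or> ordered_around S (- 1) (K v) ts v"
      using rs by (simp add: regular_net_def Ks)
    then show ?thesis using ord [OF v] True by auto
  next
    case False
    then have "ordered_around S 1 (K v) tc v \<or> ordered_around S (- 1) (K v) tc v"
      using v rc by (auto simp: regular_net_def Kc)
    then show ?thesis using ord [OF v] False by auto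
  qed
  have timelike: "lor (K v) (K v) < 0" if "v \<in> white S" for v
    using that time by (auto simp: Ks Kc)
  have X: "config_of_koebe S ((ks, ts), (kc, tc)) = (K, q)"
    by (simp only: config_of_koebe_def K_def q_def fst_conv snd_conv)
  have "K \<in> extensional (white S)" "q \<in> extensional (Vb S)" by (simp_all add: K_def q_def)
  then show "config_of_koebe S ((ks, ts), (kc, tc)) \<in> configurations S a"
    unfolding X configurations_def using q touch quad ord timelike by blast
  have e: "ks \<in> extensional (Vs S)" "ts \<in> extensional (Vb S)" "kc \<in> extensional (Vc S)" "tc \<in> extensional (Vb S)"
    using ns nc by (auto simp: koebe_net_def)
  have "restrict K (Vs S) = ks" "restrict K (Vc S) = kc"
    "(\<lambda>b \<in> Vb S. rad a (hor S b) *\<^sub>R q b) = ts" "(\<lambda>b \<in> Vb S. rad a (\<not> hor S b) *\<^sub>R q b) = tc"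
    using e q Ks Kc by (auto intro!: extensionalityI [OF restrict_extensional])
  then show "koebe_of_config S a (config_of_koebe S ((ks, ts), (kc, tc))) = ((ks, ts), (kc, tc))"
    unfolding X koebe_of_config_def by simp
qed

text \<open>The quad equations give planar faces with the right normals and make dual edge vectors
  at a corner orthogonal; alternation around each black vertex then straightens the edges.\<close>

lemma koebe_of_config:
  assumes a: "0 < a" and X: "(K, q) \<in> configurations S a"
  shows "koebe_of_config S a (K, q) \<in> koebe_pairs S (- (1 / a)\<^sup>2) (- a\<^sup>2)"
    and "config_of_koebe S (koebe_of_config S a (K, q)) = (K, q)"
proof -
  note cf = configurationsD [OF X]
  define ks kc where "ks = restrict K (Vs S)" and "kc = restrict K (Vc S)"
  define ts tc where "ts = (\<lambda>b \<in> Vb S. rad a (hor S b) *\<^sub>R q b)"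
    and "tc = (\<lambda>b \<in> Vb S. rad a (\<not> hor S b) *\<^sub>R q b)"
  have N: "koebe_of_config S a (K, q) = ((ks, ts), (kc, tc))"
    by (simp add: koebe_of_config_def ks_def kc_def ts_def tc_def)
  have ks: "ks s = K s" if "s \<in> Vs S" for s using that by (simp add: ks_def)
  have kc: "kc c = K c" if "c \<in> Vc S" for c using that by (simp add: kc_def)
  have ts: "ts b = rad a (hor S b) *\<^sub>R q b" and tc: "tc b = rad a (\<not> hor S b) *\<^sub>R q b" if "b \<in> Vb S" for b
    using that by (auto simp: ts_def tc_def)
  have pr: "proj (ts b) = q b" "proj (tc b) = q b" if "b \<in> Vb S" for b
    using that by (simp_all add: ts tc lnorm_scaleR_hyp rad_pos [OF a] cf(3))
  \<comment> \<open>This plane is polar to the vertex \<open>kc c\<close>: net vertices lie on it by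
    the quad equation, points of tangency because the radii are reciprocal. Planarity and duality
    both follow.\<close>
  have face_c: "lor (kc c) x = - 1" if c: "c \<in> Vc S" and x: "x \<in> face_points S (ks, ts) c" for c x
  proof -
    consider s b b' where "(s, b, c, b') \<in> quads S" "x = ks s" | b where "adj S c b" "x = ts b"
      using x opposite_Vc [OF c] by (auto simp: face_points_def)
    then show ?thesis
    proof cases
      case 1
      then show ?thesis using cf(7) quadD by (metis ks kc lor_commute)
    next
      case 2
      then show ?thesis using cf(5) [of c b] c adj_whiteD [of c b] rad_mult_not [OF a]
        by (simp add: kc ts lor_simps horizontal_simps)
    qed
  qed
  have face_s: "lor (ks s) x = - 1" if s: "s \<in> Vs S" and x: "x \<in> face_points S (kc, tc) s" for s x
  proof -
    consider c b b' where "(s, b, c, b') \<in> quads S" "x = kc c" | b where "adj S s b" "x = tc b"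
      using x opposite_Vs [OF s] by (auto simp: face_points_def)
    then show ?thesis
    proof cases
      case 1
      then show ?thesis using cf(7) quadD by (metis ks kc)
    next
      case 2
      then show ?thesis using cf(5) [of s b] s adj_whiteD [of s b] rad_mult_not [OF a]
        by (simp add: ks tc lor_simps horizontal_simps)
    qed
  qed
  have nz: "K v \<noteq> 0" if "v \<in> white S" for v using cf(4) [OF that] by (auto simp: lor_simps)
  \<comment> \<open>All four products of \<open>ks s\<close>, \<open>ts b\<close> with
    \<open>kc c\<close>, \<open>tc b\<close> are - 1, so they cancel.\<close>
  have quad: "lor (ks s - ts b) (kc c - tc b) = 0"
    if Q: "(s, b, c, b') \<in> quads S \<or> (s, b', c, b) \<in> quads S" for s b c b'
  proof -
    have v: "s \<in> Vs S" "c \<in> Vc S" "b \<in> Vb S" using Q quadD by blast+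
    have ad: "adj S s b" "adj S c b" using Q quad_adj by blast+
    have "lor (K s) (K c) = - 1" using Q cf(7) by blast
    then have "lor (ks s) (kc c) = - 1" by (simp only: ks [OF v(1)] kc [OF v(2)])
    moreover have "tc b \<in> face_points S (kc, tc) s" "ts b \<in> face_points S (ks, ts) c"
      using ad by (simp_all add: face_points_def)
    then have "lor (ks s) (tc b) = - 1" "lor (ts b) (kc c) = - 1"
      using face_s [OF v(1)] face_c [OF v(2)] lor_commute by metis+
    moreover have "lor (ts b) (tc b) = - 1"
      using hypD(1) [OF cf(3) [OF v(3)]] rad_mult_not(2) [OF a]
      by (simp add: ts [OF v(3)] tc [OF v(3)] lor_simps)
    ultimately show ?thesis by (simp add: lor_simps)
  qed
  have tangent: "lor (K v - rad a (horizontal S v b) *\<^sub>R q b) (q b) = 0"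
    "K v - rad a (horizontal S v b) *\<^sub>R q b \<noteq> 0" if v: "v \<in> white S" and ad: "adj S v b" for v b
    using cf(5) [OF v ad] hypD(1) [OF cf(3) [OF adj_whiteD [OF v ad]]] config_not_parallel [OF X v ad]
    by (simp_all add: lor_simps)
  have tangent_s: "lor (ks s - ts b) (q b) = 0" "ks s - ts b \<noteq> 0" if s: "s \<in> Vs S" and ad: "adj S s b" for s b
    using tangent [OF UnI1 [OF s] ad]
    by (simp_all only: ks [OF s] ts [OF adj_whiteD [OF UnI1 [OF s] ad]] horizontal_simps(1) [OF s] not_False_eq_True)
  have tangent_c: "lor (kc c - tc b) (q b) = 0" "kc c - tc b \<noteq> 0" if c: "c \<in> Vc S" and ad: "adj S c b" for c b
    using tangent [OF UnI2 [OF c] ad]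
    by (simp_all only: kc [OF c] tc [OF adj_whiteD [OF UnI2 [OF c] ad]] horizontal_simps(2) [OF c] not_False_eq_True)
  \<comment> \<open>A black boundary vertex may have many neighbours of one label; alternation puts
    them all on one line through the point of tangency.\<close>
  have lines: "collinear (edge_points S (Vs S) (ks, ts) b) \<and> collinear (edge_points S (Vc S) (kc, tc) b) \<and>
      (\<forall>x \<in> edge_points S (Vs S) (ks, ts) b. \<forall>y \<in> edge_points S (Vs S) (ks, ts) b.
       \<forall>x' \<in> edge_points S (Vc S) (kc, tc) b. \<forall>y' \<in> edge_points S (Vc S) (kc, tc) b. lor (x - y) (x' - y') = 0)"
    if b: "b \<in> Vb S" for b
  proof -
    define D where "D v = (if v \<in> Vs S then ks v - ts b else kc v - tc b)" for v
    have D: "D v \<noteq> 0" "lor (D v) (q b) = 0" if "adj S v b" for v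
    proof -
      have "v \<in> white S"
      proof -
        have "adj S b v" using that adj_sym [of v b] by blast
        then obtain y where "turn S b v y \<or> turn S b y v" unfolding adj_def by blast
        then show ?thesis by (elim disjE; elim turn_blackE [OF b]) (use quadD in blast)+
      qed
      then show "D v \<noteq> 0" "lor (D v) (q b) = 0"
        using tangent_s [of v b] tangent_c [of v b] that by (auto simp: D_def)
    qed
    have orth: "lor (D s) (D c) = 0" if Q: "(s, b, c, b') \<in> quads S \<or> (s, b', c, b) \<in> quads S" for s c b'
    proof -
      have "s \<in> Vs S" "c \<in> Vc S" using Q quadD by blast+
      then have "s \<in> Vs S" "c \<notin> Vs S" using disjoint_classes by blast+
      then show ?thesis using quad [OF Q] by (simp add: D_def)
    qed
    have neg: "lor (q b) (q b) < 0" using hypD(1) [OF cf(3) [OF b]] by simp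
    have "\<exists>e e'. lor e e' = 0 \<and> (\<forall>v \<in> Vs S. adj S v b \<longrightarrow> (\<exists>m. D v = m *\<^sub>R e)) \<and>
        (\<forall>v \<in> Vc S. adj S v b \<longrightarrow> (\<exists>m. D v = m *\<^sub>R e'))"
      by (rule alternating_directions [OF b neg D orth])
    then obtain e e' where e: "lor e e' = 0"
      "\<And>v. v \<in> Vs S \<Longrightarrow> adj S v b \<Longrightarrow> \<exists>m. D v = m *\<^sub>R e"
      "\<And>v. v \<in> Vc S \<Longrightarrow> adj S v b \<Longrightarrow> \<exists>m. D v = m *\<^sub>R e'"
      by blast
    have multiples: "\<exists>m. x - y = m *\<^sub>R d" if xy: "\<exists>m. x - t = m *\<^sub>R d" "\<exists>m. y - t = m *\<^sub>R d"
      for x y t d :: "real ^ 3"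
    proof -
      obtain m m' where "x - t = m *\<^sub>R d" "y - t = m' *\<^sub>R d" using xy by blast
      then have "x - y = (m - m') *\<^sub>R d" by (metis diff_diff_eq2 diff_add_cancel scaleR_left_diff_distrib)
      then show ?thesis ..
    qed
    \<comment> \<open>The point of tangency is itself in \<open>edge_points\<close>, as the multiple
      0.\<close>
    have zero: "\<exists>m. 0 = m *\<^sub>R d" for d :: "real ^ 3" by (rule exI [of _ 0]) simp
    have "\<exists>m. ks v - ts b = m *\<^sub>R e" if "v \<in> Vs S" "adj S v b" for v
      using e(2) [OF that] that by (simp add: D_def)
    then have s: "\<exists>m. x - ts b = m *\<^sub>R e" if "x \<in> edge_points S (Vs S) (ks, ts) b" for x
      using that zero unfolding edge_points_def by auto
    have "\<exists>m. kc v - tc b = m *\<^sub>R e'" if "v \<in> Vc S" "adj S v b" for v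
    proof -
      have "v \<notin> Vs S" using that(1) disjoint_classes(1) by blast
      then show ?thesis using e(3) [OF that] by (simp add: D_def)
    qed
    then have c: "\<exists>m. x - tc b = m *\<^sub>R e'" if "x \<in> edge_points S (Vc S) (kc, tc) b" for x
      using that zero unfolding edge_points_def by auto
    note ms = multiples [OF s s] and mc = multiples [OF c c]
    have "lor (x - y) (x' - y') = 0"
      if xy: "x \<in> edge_points S (Vs S) (ks, ts) b" "y \<in> edge_points S (Vs S) (ks, ts) b"
        "x' \<in> edge_points S (Vc S) (kc, tc) b" "y' \<in> edge_points S (Vc S) (kc, tc) b" for x y x' y'
    proof -
      obtain m m' where "x - y = m *\<^sub>R e" "x' - y' = m' *\<^sub>R e'"
        using ms [OF xy(1,2)] mc [OF xy(3,4)] by blast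
      then show ?thesis using e(1) by (metis lor_simps(5,6) mult_zero_right)
    qed
    then show ?thesis using ms mc unfolding collinear_def by blast
  qed
  have sphere: "ts b \<in> upper_sphere (if hor S b then - a\<^sup>2 else - (1 / a)\<^sup>2)"
    "tc b \<in> upper_sphere (if \<not> hor S b then - a\<^sup>2 else - (1 / a)\<^sup>2)" if b: "b \<in> Vb S" for b
  proof -
    have "rad a h *\<^sub>R q b \<in> upper_sphere (- (rad a h)\<^sup>2)" for h
      using upper_sphere_iff [OF rad_pos [OF a]] cf(3) [OF b] by blast
    from this [of "hor S b"] this [of "\<not> hor S b"]
    show "ts b \<in> upper_sphere (if hor S b then - a\<^sup>2 else - (1 / a)\<^sup>2)"
      "tc b \<in> upper_sphere (if \<not> hor S b then - a\<^sup>2 else - (1 / a)\<^sup>2)"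
      unfolding ts [OF b] tc [OF b] rad_def by (simp_all split: if_splits)
  qed
  have touch: "x \<in> edge_points S (Vs S) (ks, ts) b \<Longrightarrow> lor (x - ts b) (ts b) = 0"
    "x \<in> edge_points S (Vc S) (kc, tc) b \<Longrightarrow> lor (x - tc b) (tc b) = 0" if b: "b \<in> Vb S" for b x
    using tangent_s(1) [of _ b] tangent_c(1) [of _ b] ts [OF b] tc [OF b]
    by (auto simp: edge_points_def lor_simps)
  have nzs: "ks s \<noteq> 0" if "s \<in> Vs S" for s using nz ks that by simp
  have nzc: "kc c \<noteq> 0" if "c \<in> Vc S" for c using nz kc that by simp
  have ext: "ks \<in> extensional (Vs S)" "ts \<in> extensional (Vb S)" "kc \<in> extensional (Vc S)" "tc \<in> extensional (Vb S)"
    by (simp_all add: ks_def ts_def kc_def tc_def)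
  have coplanar: "c \<in> Vc S \<Longrightarrow> coplanar (face_points S (ks, ts) c)" "s \<in> Vs S \<Longrightarrow> coplanar (face_points S (kc, tc) s)" for c s
    using coplanar_lor [OF nzc face_c] coplanar_lor [OF nzs face_s] by blast+
  have net: "koebe_net S (Vs S) (Vc S) {b \<in> Vb S. hor S b} (- (1 / a)\<^sup>2) (- a\<^sup>2) (ks, ts)"
    "koebe_net S (Vc S) (Vs S) {b \<in> Vb S. \<not> hor S b} (- (1 / a)\<^sup>2) (- a\<^sup>2) (kc, tc)"
    unfolding koebe_net_def using ext coplanar sphere lines touch by simp_all
  have ord_s: "ordered_around S \<sigma> (K s) ts s \<longleftrightarrow> ordered_around S \<sigma> (K s) q s" if s: "s \<in> Vs S" for s \<sigma>
    using ordered_around_scaleR [OF UnI1 [OF s] zero_less_one, of ts q \<sigma> "K s"]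
      adj_whiteD [OF UnI1 [OF s]] ts rad_pos [OF a] by auto
  have ord_c: "ordered_around S \<sigma> (K c) tc c \<longleftrightarrow> ordered_around S \<sigma> (K c) q c" if c: "c \<in> Vc S" for c \<sigma>
    using ordered_around_scaleR [OF UnI2 [OF c] zero_less_one, of tc q \<sigma> "K c"]
      adj_whiteD [OF UnI2 [OF c]] tc rad_pos [OF a] by auto
  have reg: "regular_net S (Vs S) (ks, ts)" "regular_net S (Vc S) (kc, tc)"
    unfolding regular_net_def using cf(6) by (simp_all add: ks kc ord_s ord_c)
  have timelike: "lor (ks s) (ks s) < 0" if "s \<in> Vs S" for s using cf(4) that by (simp add: ks)
  have timelike': "lor (kc c) (kc c) < 0" if "c \<in> Vc S" for c using cf(4) that by (simp add: kc)
  have normal: "lor (kc c) (x - y) = 0"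
    if "c \<in> Vc S" "x \<in> face_points S (ks, ts) c" "y \<in> face_points S (ks, ts) c" for c x y
    using face_c that by (simp add: lor_simps)
  have normal': "lor (ks s) (x - y) = 0"
    if "s \<in> Vs S" "x \<in> face_points S (kc, tc) s" "y \<in> face_points S (kc, tc) s" for s x y
    using face_s that by (simp add: lor_simps)
  have "dual_nets S (- (1 / a)\<^sup>2) (- a\<^sup>2) (ks, ts) (kc, tc)"
    unfolding dual_nets_def fst_conv snd_conv using net nzs nzc normal normal' lines pr by presburger
  then show "koebe_of_config S a (K, q) \<in> koebe_pairs S (- (1 / a)\<^sup>2) (- a\<^sup>2)"
    unfolding N koebe_pairs_def using reg timelike timelike' by simp
  have "config_of_koebe S ((ks, ts), (kc, tc)) = (K, q)"
    using cf(1,2) pr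
    by (auto simp: config_of_koebe_def ks kc intro!: extensionalityI [OF restrict_extensional])
  then show "config_of_koebe S (koebe_of_config S a (K, q)) = (K, q)" by (simp add: N)
qed


section \<open>Configurations and ring patterns\<close>

text \<open>Otherwise \<open>- K v\<close> would lie in the future cone, making
  \<open>lor (K v) (q b)\<close> positive, whereas tangency prescribes a negative value.\<close>

lemma config_future:
  assumes a: "0 < a" and X: "(K, q) \<in> configurations S a" and v: "v \<in> white S"
  shows "K v $ 3 > 0"
proof (rule ccontr)
  assume neg: "\<not> K v $ 3 > 0"
  note cf = configurationsD [OF X]
  obtain b where b: "adj S v b" using white_horizontal [OF v] by blast
  have "K v $ 3 \<noteq> 0"
  proof
    assume "K v $ 3 = 0"
    then have "lor (K v) (K v) = (K v $ 1)\<^sup>2 + (K v $ 2)\<^sup>2" by (simp add: lor_def power2_eq_square)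
    then have "lor (K v) (K v) \<ge> 0" by simp
    with cf(4) [OF v] show False by linarith
  qed
  then have up: "(- K v) $ 3 > 0" using neg by simp
  have "lor (- K v) (- K v) < 0" using cf(4) [OF v] by (simp add: lor_def)
  from lor_future_neg [OF this up cf(3) [OF adj_whiteD [OF v b]]]
  have "lor (K v) (q b) > 0" by (simp add: lor_def)
  moreover have "lor (K v) (q b) < 0"
    using rad_pos [OF a] by (simp only: cf(5) [OF v b] neg_less_0_iff_less)
  ultimately show False by linarith
qed

text \<open>The quotient \<open>a / lnorm (K v)\<close>, the future \<open>cosh r\<close>, is minus
  the product of the centre with a touching point on a horizontal edge. By regularity the two points
  differ, so it exceeds 1; \<open>a < 1\<close> makes the outer radius larger.\<close>

lemma config_centre:
  assumes a: "0 < a" "a < 1" and X: "(K, q) \<in> configurations S a" and v: "v \<in> white S"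
  shows "proj (K v) \<in> hyp" "lnorm (K v) > 0" "K v = lnorm (K v) *\<^sub>R proj (K v)"
    and "1 < a / lnorm (K v)" "a / lnorm (K v) < 1 / a / lnorm (K v)"
    and "adj S v b \<Longrightarrow> lor (proj (K v)) (q b) = - (rad a (horizontal S v b) / lnorm (K v))"
proof -
  note cf = configurationsD [OF X]
  show p: "proj (K v) \<in> hyp" and l: "lnorm (K v) > 0" and K: "K v = lnorm (K v) *\<^sub>R proj (K v)"
    using proj_hyp [OF cf(4) [OF v] config_future [OF a(1) X v]] by simp_all
  show pq: "lor (proj (K v)) (q b) = - (rad a (horizontal S v b) / lnorm (K v))" if ad: "adj S v b" for b
  proof -
    have "lor (proj (K v)) (q b) = lor (K v) (q b) / lnorm (K v)"
      by (simp add: proj_def lor_simps divide_inverse mult.commute)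
    then show ?thesis using cf(5) [OF v ad] by simp
  qed
  obtain b where b: "adj S v b" "horizontal S v b" using white_horizontal [OF v] by blast
  have "proj (K v) \<noteq> q b" using config_not_parallel [OF X v b(1)] K by metis
  then have "lor (proj (K v)) (q b) < - 1"
    using lor_hyp_less [OF p] cf(3) [OF adj_whiteD [OF v b(1)]] by blast
  then show "1 < a / lnorm (K v)" using pq [OF b(1)] b(2) by (simp add: rad_def)
  have "a < 1 / a" using a less_trans [of a 1 "1 / a"] by simp
  then show "a / lnorm (K v) < 1 / a / lnorm (K v)" using l by (intro divide_strict_right_mono)
qed

text \<open>Circles are level sets of \<open>lor\<close>, so the metric conditions on rings are the
  equations of the configuration divided by the lengths of the vertex vectors.\<close>

lemma rings_of_config:
  assumes a: "0 < a" "a < 1" and X: "(K, q) \<in> configurations S a"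
  shows "rings_of_config S a (K, q) \<in> ring_patterns S (a\<^sup>2)"
    and "config_of_rings S a (rings_of_config S a (K, q)) = (K, q)"
proof -
  note cf = configurationsD [OF X]
  note centre = config_centre [OF a X]
  define \<rho> where "\<rho> = fst (rings_of_config S a (K, q))"
  have R: "rings_of_config S a (K, q) = (\<rho>, q)" by (simp add: \<rho>_def rings_of_config_def)
  have ctr: "ctr (\<rho> v) = proj (K v)"
    and inr: "inr (\<rho> v) = (if ordered_around S 1 (K v) q v then 1 else - 1) * arcosh (a / lnorm (K v))"
    and outr: "outr (\<rho> v) = arcosh (1 / a / lnorm (K v))"
    if "v \<in> white S" for v
    using that by (simp_all add: \<rho>_def rings_of_config_def)
  have arc: "arcosh (a / lnorm (K v)) > 0" "arcosh (a / lnorm (K v)) < arcosh (1 / a / lnorm (K v))"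
    if "v \<in> white S" for v
    using arcosh_real_strict_mono [of 1 "a / lnorm (K v)"] centre(4) [OF that]
      arcosh_real_strict_mono [OF less_imp_le [OF centre(4)] centre(5), OF that that]
    by simp_all
  have abs_inr: "\<bar>inr (\<rho> v)\<bar> = arcosh (a / lnorm (K v))" if "v \<in> white S" for v
    using arc(1) [OF that] by (simp add: inr [OF that])
  have cosh_inr: "cosh (inr (\<rho> v)) = a / lnorm (K v)" if "v \<in> white S" for v
    using abs_inr [OF that] centre(4) [OF that] by (metis cosh_real_abs cosh_arcosh_real less_imp_le)
  have cosh_outr: "cosh (outr (\<rho> v)) = 1 / a / lnorm (K v)" if "v \<in> white S" for v
    using centre(4,5) [OF that] unfolding outr [OF that] by (intro cosh_arcosh_real) linarith
  have ring: "is_hring (\<rho> v)" if "v \<in> white S" for v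
    using centre(1) [OF that] abs_inr [OF that] arc [OF that] by (auto simp: is_hring_def ctr [OF that] outr [OF that])
  have on: "q b \<in> hcircle (ctr (\<rho> v)) (if horizontal S v b then \<bar>inr (\<rho> v)\<bar> else outr (\<rho> v))"
    if v: "v \<in> white S" and ad: "adj S v b" for v b
  proof -
    have "outr (\<rho> v) \<ge> 0" using ring [OF v] by (auto simp: is_hring_def)
    then show ?thesis
      using cf(3) [OF adj_whiteD [OF v ad]] centre(1,6) [OF v] ad
      by (simp add: hcircle_iff ctr [OF v] cosh_inr [OF v] cosh_outr [OF v] rad_def)
  qed
  have orth: "orthogonal_circles (ctr (\<rho> s)) (outr (\<rho> s)) (ctr (\<rho> c)) \<bar>inr (\<rho> c)\<bar> \<and>
      orthogonal_circles (ctr (\<rho> s)) \<bar>inr (\<rho> s)\<bar> (ctr (\<rho> c)) (outr (\<rho> c))"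
    if Q: "(s, b, c, b') \<in> quads S" for s b c b'
  proof -
    note v = UnI1 [OF quadD(1) [OF Q]] UnI2 [OF quadD(3) [OF Q]]
    have r: "outr (\<rho> s) > 0" "\<bar>inr (\<rho> s)\<bar> > 0" "outr (\<rho> c) > 0" "\<bar>inr (\<rho> c)\<bar> > 0"
      using ring [OF v(1)] ring [OF v(2)] by (auto simp: is_hring_def)
    have "lor (proj (K s)) (proj (K c)) = lor (K s) (K c) / (lnorm (K s) * lnorm (K c))"
      by (simp add: proj_def lor_simps divide_inverse)
    then have "lor (ctr (\<rho> s)) (ctr (\<rho> c)) = - 1 / (lnorm (K s) * lnorm (K c))"
      using cf(7) [OF Q] by (simp add: ctr [OF v(1)] ctr [OF v(2)])
    \<comment> \<open>In either pairing the factors \<open>a\<close> and \<open>1 / a\<close> of the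
      two cosines cancel.\<close>
    then have pp: "lor (ctr (\<rho> s)) (ctr (\<rho> c)) = - (cosh (outr (\<rho> s)) * cosh \<bar>inr (\<rho> c)\<bar>)"
      "lor (ctr (\<rho> s)) (ctr (\<rho> c)) = - (cosh \<bar>inr (\<rho> s)\<bar> * cosh (outr (\<rho> c)))"
      using a by (simp_all add: cosh_inr [OF v(1)] cosh_inr [OF v(2)] cosh_outr [OF v(1)] cosh_outr [OF v(2)])
    note on_s = on [OF v(1) quad_adj(1) [OF Q]] on [OF v(1) quad_adj(2) [OF Q]]
    note on_c = on [OF v(2) quad_adj(3) [OF Q]] on [OF v(2) quad_adj(4) [OF Q]]
    note hz = horizontal_simps(1) [OF quadD(1) [OF Q]] horizontal_simps(2) [OF quadD(3) [OF Q]] quadD(5) [OF Q]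
    \<comment> \<open>The black vertices of the quad have opposite colours: the one with
      \<open>hor\<close> false lies on the outer s-circle and the inner c-circle, the other on the
      remaining pair.\<close>
    have "hcircle (ctr (\<rho> s)) (outr (\<rho> s)) \<inter> hcircle (ctr (\<rho> c)) \<bar>inr (\<rho> c)\<bar> \<noteq> {} \<and>
        hcircle (ctr (\<rho> s)) \<bar>inr (\<rho> s)\<bar> \<inter> hcircle (ctr (\<rho> c)) (outr (\<rho> c)) \<noteq> {}"
    proof (cases "hor S b'")
      case True
      then show ?thesis using on_s on_c unfolding hz by auto
    next
      case False
      then show ?thesis using on_s on_c unfolding hz by auto
    qed
    then show ?thesis
      using orthogonal_if_lor_centres [OF _ _ r(1,4) pp(1)] orthogonal_if_lor_centres [OF _ _ r(2,3) pp(2)]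
        centre(1) [OF v(1)] centre(1) [OF v(2)] by (simp add: ctr [OF v(1)] ctr [OF v(2)])
  qed
  have scale: "ordered_around S \<sigma> (ctr (\<rho> v)) q v \<longleftrightarrow> ordered_around S \<sigma> (K v) q v" if v: "v \<in> white S" for v \<sigma>
    using ordered_around_scaleR [OF v centre(2) [OF v], of q q \<sigma> "proj (K v)"] centre(3) [OF v] zero_less_one
    by (metis ctr [OF v] scaleR_one)
  have ord: "(inr (\<rho> v) > 0 \<longrightarrow> ordered_around S 1 (ctr (\<rho> v)) q v) \<and>
      (inr (\<rho> v) < 0 \<longrightarrow> ordered_around S (- 1) (ctr (\<rho> v)) q v)" if v: "v \<in> white S" for v
    using cf(6) [OF v] arc(1) [OF v] unfolding scale [OF v] inr [OF v] by auto
  have "\<rho> \<in> extensional (white S)" by (simp add: \<rho>_def rings_of_config_def)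
  then have pattern: "ring_pattern S \<rho> q" unfolding ring_pattern_def using cf(2) ring orth on ord by auto
  have "a\<^sup>2 * cosh (outr (\<rho> v)) = cosh (inr (\<rho> v))" if v: "v \<in> white S" for v
    using a by (simp add: cosh_inr [OF v] cosh_outr [OF v] power2_eq_square)
  then show "rings_of_config S a (K, q) \<in> ring_patterns S (a\<^sup>2)"
    unfolding R ring_patterns_def global_parameter_def using pattern by simp
  \<comment> \<open>By the formula for \<open>cosh R\<close> the factor is
    \<open>lnorm (K v)\<close>.\<close>
  have "(1 / (a * cosh (outr (\<rho> v)))) *\<^sub>R ctr (\<rho> v) = K v" if v: "v \<in> white S" for v
    using a centre(3) [OF v] by (simp add: cosh_outr [OF v] ctr [OF v])
  then have "(\<lambda>v \<in> white S. (1 / (a * cosh (outr (\<rho> v)))) *\<^sub>R ctr (\<rho> v)) = K"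
    by (intro extensionalityI [OF restrict_extensional cf(1)]) simp
  then show "config_of_rings S a (rings_of_config S a (K, q)) = (K, q)"
    unfolding R config_of_rings_def fst_conv snd_conv by simp
qed

text \<open>Scaling by \<open>l\<close> turns the cosines of outer and inner radii into the sphere
  radii \<open>1 / a\<close> and \<open>a\<close>; hyperbolic Pythagoras then yields the quad
  equation.\<close>

lemma config_of_rings:
  assumes a: "0 < a" and P: "(\<rho>, q) \<in> ring_patterns S (a\<^sup>2)"
  shows "config_of_rings S a (\<rho>, q) \<in> configurations S a"
    and "rings_of_config S a (config_of_rings S a (\<rho>, q)) = (\<rho>, q)"
proof -
  have ext: "\<rho> \<in> extensional (white S)" "q \<in> extensional (Vb S)"
    and ring: "\<And>v. v \<in> white S \<Longrightarrow> is_hring (\<rho> v)"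
    and orth: "\<And>s b c b'. (s, b, c, b') \<in> quads S \<Longrightarrow>
        orthogonal_circles (ctr (\<rho> s)) (outr (\<rho> s)) (ctr (\<rho> c)) \<bar>inr (\<rho> c)\<bar>"
    and on: "\<And>v b. b \<in> Vb S \<Longrightarrow> v \<in> white S \<Longrightarrow> adj S v b \<Longrightarrow>
        q b \<in> hcircle (ctr (\<rho> v)) (if horizontal S v b then \<bar>inr (\<rho> v)\<bar> else outr (\<rho> v))"
    and ord: "\<And>v. v \<in> white S \<Longrightarrow> inr (\<rho> v) > 0 \<Longrightarrow> ordered_around S 1 (ctr (\<rho> v)) q v"
      "\<And>v. v \<in> white S \<Longrightarrow> inr (\<rho> v) < 0 \<Longrightarrow> ordered_around S (- 1) (ctr (\<rho> v)) q v"
    and glob: "\<And>v. v \<in> white S \<Longrightarrow> a\<^sup>2 * cosh (outr (\<rho> v)) = cosh (inr (\<rho> v))"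
    using P unfolding ring_patterns_def ring_pattern_def global_parameter_def by blast+
  define l where "l v = 1 / (a * cosh (outr (\<rho> v)))" for v
  define K where "K = (\<lambda>v \<in> white S. l v *\<^sub>R ctr (\<rho> v))"
  have C: "config_of_rings S a (\<rho>, q) = (K, q)" by (simp only: config_of_rings_def K_def l_def fst_conv snd_conv)
  have K: "K v = l v *\<^sub>R ctr (\<rho> v)" if "v \<in> white S" for v using that by (simp add: K_def)
  have l: "l v > 0" for v using a by (simp add: l_def)
  have l_out: "l v * cosh (outr (\<rho> v)) = 1 / a" for v using a by (simp add: l_def)
  \<comment> \<open>The global parameter enters here: \<open>l\<close> is chosen from the outer
    radius, and \<open>glob\<close> makes it fit the inner one as well.\<close>
  have l_in: "l v * cosh (inr (\<rho> v)) = a" if v: "v \<in> white S" for v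
    using a by (simp add: l_def glob [OF v, symmetric] power2_eq_square)
  have ringD: "ctr (\<rho> v) \<in> hyp" "inr (\<rho> v) \<noteq> 0" "outr (\<rho> v) \<ge> 0" if "v \<in> white S" for v
    using ring [OF that] by (auto simp: is_hring_def)
  have onD: "q b \<in> hyp" "lor (ctr (\<rho> v)) (q b) = - cosh (if horizontal S v b then inr (\<rho> v) else outr (\<rho> v))"
    if v: "v \<in> white S" and ad: "adj S v b" for v b
    using on [OF adj_whiteD [OF v ad] v ad] ringD [OF v] by (simp_all add: hcircle_iff split: if_splits)
  have qh: "q b \<in> hyp" if b: "b \<in> Vb S" for b
  proof -
    \<comment> \<open>A black vertex lies in some quad, so \<open>q b\<close> lies on a circle about
      a white neighbour.\<close>
    obtain s c b' where Q: "(s, b, c, b') \<in> quads S \<or> (s, b', c, b) \<in> quads S" using black_quad [OF b] by blast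
    have "s \<in> Vs S" using Q quadD by blast
    moreover have "adj S s b" using Q quad_adj by blast
    ultimately show ?thesis using onD(1) by blast
  qed
  have touch: "lor (K v) (q b) = - rad a (horizontal S v b)" if v: "v \<in> white S" and ad: "adj S v b" for v b
    using onD(2) [OF v ad] l_out [of v] l_in [OF v] by (simp add: K [OF v] lor_simps rad_def)
  have time: "lor (K v) (K v) < 0" if v: "v \<in> white S" for v
    using hypD(1) [OF ringD(1) [OF v]] l [of v] by (simp add: K [OF v] lor_simps)
  have scale: "ordered_around S \<sigma> (K v) q v \<longleftrightarrow> ordered_around S \<sigma> (ctr (\<rho> v)) q v" if v: "v \<in> white S" for v \<sigma>
    using ordered_around_scaleR [OF v l, of q q] K [OF v] zero_less_one by (metis scaleR_one)
  \<comment> \<open>The pattern gives the order from the sign; uniqueness of the sense gives the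
    converse.\<close>
  have ord': "ordered_around S 1 (K v) q v \<longleftrightarrow> inr (\<rho> v) > 0"
    "ordered_around S 1 (K v) q v \<or> ordered_around S (- 1) (K v) q v" if v: "v \<in> white S" for v
    using ord [OF v] ordered_around_unique [OF v] ringD(2) [OF v] unfolding scale [OF v]
    by (metis linorder_neqE_linordered_idom)+
  have quad: "lor (K s) (K c) = - 1" if Q: "(s, b, c, b') \<in> quads S" for s b c b'
  proof -
    note v = UnI1 [OF quadD(1) [OF Q]] UnI2 [OF quadD(3) [OF Q]]
    have "lor (ctr (\<rho> s)) (ctr (\<rho> c)) = - (cosh (outr (\<rho> s)) * cosh \<bar>inr (\<rho> c)\<bar>)"
      by (intro lor_centres_if_orthogonal orth [OF Q]) (use ringD v in auto)
    then have "lor (K s) (K c) = - ((l s * cosh (outr (\<rho> s))) * (l c * cosh (inr (\<rho> c))))"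
      by (simp add: K [OF v(1)] K [OF v(2)] lor_simps)
    then show ?thesis using a by (simp add: l_out l_in [OF v(2)])
  qed
  have "K \<in> extensional (white S)" by (simp add: K_def)
  then show "config_of_rings S a (\<rho>, q) \<in> configurations S a"
    unfolding C configurations_def using ext(2) qh touch time ord'(2) quad by blast
  have "\<lparr>ctr = proj (K v),
      inr = (if ordered_around S 1 (K v) q v then 1 else - 1) * arcosh (a / lnorm (K v)),
      outr = arcosh (1 / a / lnorm (K v))\<rparr> = \<rho> v" if v: "v \<in> white S" for v
  proof -
    have K': "proj (K v) = ctr (\<rho> v)" "lnorm (K v) = l v"
      using lnorm_scaleR_hyp [OF ringD(1) [OF v] l [of v]] K [OF v] by simp_all
    \<comment> \<open>\<open>cosh\<close> forgets the sign, so \<open>arcosh\<close> returns the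
      absolute value; the sign comes back through \<open>ord'\<close>.\<close>
    have "a / l v = cosh \<bar>inr (\<rho> v)\<bar>" using l_in [OF v] l [of v] by (simp add: field_simps)
    then have i: "arcosh (a / l v) = \<bar>inr (\<rho> v)\<bar>" by (simp only: arcosh_cosh_real abs_ge_zero)
    have "1 / a / l v = cosh (outr (\<rho> v))" using l_out [of v, symmetric] l [of v] by simp
    then have "arcosh (1 / a / l v) = outr (\<rho> v)" using ringD(3) [OF v] by (simp only: arcosh_cosh_real)
    then show ?thesis using ringD(2) [OF v] unfolding K' i ord'(1) [OF v] by (auto intro!: hring.equality)
  qed
  then have "(\<lambda>v \<in> white S. \<lparr>ctr = proj (K v),
      inr = (if ordered_around S 1 (K v) q v then 1 else - 1) * arcosh (a / lnorm (K v)),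
      outr = arcosh (1 / a / lnorm (K v))\<rparr>) = \<rho>"
    by (intro extensionalityI [OF restrict_extensional ext(1)]) simp
  then show "rings_of_config S a (config_of_rings S a (\<rho>, q)) = (\<rho>, q)"
    unfolding C rings_of_config_def fst_conv snd_conv by simp
qed

section \<open>Composition of the two bijections\<close>

lemma bij_betw_config_of_koebe:
  assumes "0 < a"
  shows "bij_betw (config_of_koebe S) (koebe_pairs S (- (1 / a)\<^sup>2) (- a\<^sup>2)) (configurations S a)"
  using config_of_koebe(1,2) [OF assms] koebe_of_config [OF assms]
  by (intro bij_betw_byWitness [where f' = "koebe_of_config S a"]) auto

lemma bij_betw_rings_of_config:
  assumes "0 < a" "a < 1"
  shows "bij_betw (rings_of_config S a) (configurations S a) (ring_patterns S (a\<^sup>2))"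
  using rings_of_config [OF assms] config_of_rings [OF assms(1)]
  by (intro bij_betw_byWitness [where f' = "config_of_rings S a"]) auto

end

theorem theorem11p1:
  fixes S :: "'v squad" and rp2 rm2 :: real
  assumes "s_quad_graph S"
    and "rp2 < 0" and "rm2 < 0" and "rp2 * rm2 = 1"
    and "\<bar>sqrt rm2\<bar> < \<bar>sqrt rp2\<bar>"
  shows "\<exists>\<Phi>. bij_betw \<Phi> (koebe_pairs S rp2 rm2)
                (ring_patterns S (\<bar>sqrt rm2\<bar> / \<bar>sqrt rp2\<bar>)) \<and>
           (\<forall>ks ts kc tc \<rho> q.
              ((ks, ts), (kc, tc)) \<in> koebe_pairs S rp2 rm2 \<and>
              \<Phi> ((ks, ts), (kc, tc)) = (\<rho>, q) \<longrightarrow>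
                (\<forall>s \<in> Vs S. ctr (\<rho> s) = proj (ks s)) \<and>
                (\<forall>c \<in> Vc S. ctr (\<rho> c) = proj (kc c)) \<and>
                (\<forall>b \<in> Vb S. q b = proj (ts b) \<and> q b = proj (tc b)))"
proof -
  interpret squad_graph S by unfold_locales (rule assms(1))
  \<comment> \<open>The single parameter |r_-|; the other radius is its reciprocal.\<close>
  define a where "a = \<bar>sqrt rm2\<bar>"
  have a: "0 < a" using assms(3) by (simp add: a_def)
  have rm: "rm2 = - a\<^sup>2" using assms(3) by (simp add: a_def power2_eq_square)
  \<comment> \<open>The real \<open>sqrt\<close> is multiplicative on negative numbers too, being
    odd.\<close>
  have "\<bar>sqrt rp2\<bar> * a = 1"
    using assms(4) by (simp add: a_def abs_mult [symmetric] real_sqrt_mult [symmetric])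
  then have inv: "\<bar>sqrt rp2\<bar> = 1 / a" using a by (simp add: field_simps)
  have "rp2 = - \<bar>sqrt rp2\<bar>\<^sup>2" using assms(2) by (simp add: power2_eq_square)
  then have rp: "rp2 = - (1 / a)\<^sup>2" unfolding inv .
  \<comment> \<open>Otherwise \<open>1 / a \<le> 1 \<le> a\<close>, against |r_-| < |r_+|.\<close>
  have "a < 1"
  proof (rule ccontr)
    assume "\<not> a < 1"
    then have "1 / a \<le> 1" by simp
    then show False using assms(5) \<open>\<not> a < 1\<close> unfolding inv a_def [symmetric] by linarith
  qed
  have q: "\<bar>sqrt rm2\<bar> / \<bar>sqrt rp2\<bar> = a\<^sup>2" unfolding inv a_def [symmetric] by (simp add: power2_eq_square)
  have "bij_betw (rings_of_config S a \<circ> config_of_koebe S) (koebe_pairs S rp2 rm2) (ring_patterns S (\<bar>sqrt rm2\<bar> / \<bar>sqrt rp2\<bar>))"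
    unfolding q unfolding rp rm
    by (rule bij_betw_trans [OF bij_betw_config_of_koebe [OF a] bij_betw_rings_of_config [OF a \<open>a < 1\<close>]])
  moreover have "(\<forall>s \<in> Vs S. ctr (\<rho> s) = proj (ks s)) \<and> (\<forall>c \<in> Vc S. ctr (\<rho> c) = proj (kc c)) \<and>
      (\<forall>b \<in> Vb S. q b = proj (ts b) \<and> q b = proj (tc b))"
    if N: "((ks, ts), (kc, tc)) \<in> koebe_pairs S rp2 rm2"
      and e: "(rings_of_config S a \<circ> config_of_koebe S) ((ks, ts), (kc, tc)) = (\<rho>, q)" for ks ts kc tc \<rho> q
  proof -
    \<comment> \<open>The configuration is built from \<open>ts\<close>; duality extends the claim
      on touching points to \<open>tc\<close>.\<close>
    have "proj (ts b) = proj (tc b)" if "b \<in> Vb S" for b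
      using config_of_koebe(3) [OF a N [unfolded rp rm] that] .
    then show ?thesis
      using e disjoint_classes(1) by (auto simp: rings_of_config_def config_of_koebe_def)
  qed
  ultimately show ?thesis by blast
qed

end
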